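(* Fix a small constant $\varepsilon>0$. For each $n$, let $X$ and $Y$ be independent random graphs with $X\in\mathcal{G}(n,p_1)$ and $Y\in\mathcal{G}(n,p_2)$, where $p_1=p_1(n)$ and $p_2=p_2(n)$ depend on $n$. Let $p_0=\frac{\exp\left(2(\log n)^{2/3}\right)}{n^{1/2}}$. \begin{enumerate} \item If either (i) $p_1p_2\le \frac{(1-\varepsilon)/2}{n}$ and both $p_1,p_2\gg \frac{\log n}{n}$ (i.e. $\frac{\log n}{n}=o(p_1)$ and $\frac{\log n}{n}=o(p_2)$), or (ii) $\min\{p_1,p_2\}\le \frac{\log n+c(n)}{n}$ for some function $c(n)\to-\infty$, then $\mathsf{FS}(X,Y)$ is disconnected with high probability. \item If $p_1p_2\ge p_0^2$ and $p_1,p_2\ge \frac{2}{(\log n)^{1/3}}\,p_0$, then $\mathsf{FS}(X,Y)$ is connected with high probability. \end{enumerate}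
   Context: All graphs are finite and simple. For graphs $X$ and $Y$ each with $n$ vertices, the friends-and-strangers graph $\mathsf{FS}(X,Y)$ is the graph whose vertex set is the set of all bijections $\sigma:V(X)\to V(Y)$, where two bijections $\sigma,\sigma'$ are adjacent if and only if there exist $a,b\in V(X)$ with $\{a,b\}\in E(X)$ such that $\{\sigma(a),\sigma(b)\}\in E(Y)$, $\sigma'(a)=\sigma(b)$, $\sigma'(b)=\sigma(a)$, and $\sigma'(c)=\sigma(c)$ for all $c\in V(X)\setminus\{a,b\}$. $\mathcal{G}(n,p)$ denotes the Erdős–Rényi random graph on $n$ vertices in which each pair is an edge independently with probability $p$. A sequence of events $\mathcal{A}_n$ holds with high probability if $\Pr(\mathcal{A}_n)\to1$ as $n\to\infty$. $\log$ is the natural logarithm. *)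

theory Defs
  imports Complex_Main "HOL-Library.Landau_Symbols" "HOL-Combinatorics.Permutations"
begin

text \<open>Graphs on the vertex set {0..<n}: a graph is given by its edge set,
a set of 2-element subsets of {0..<n}.\<close>

definition all_edges :: "nat \<Rightarrow> nat set set" where
  "all_edges n = {e. \<exists>a b. a < n \<and> b < n \<and> a \<noteq> b \<and> e = {a, b}}"

definition graphs :: "nat \<Rightarrow> nat set set set" where
  "graphs n = Pow (all_edges n)"

text \<open>Probability that G(n,p) equals the graph with edge set E.\<close>
definition gnp_prob :: "nat \<Rightarrow> real \<Rightarrow> nat set set \<Rightarrow> real" where
  "gnp_prob n p E = p ^ card E * (1 - p) ^ (card (all_edges n) - card E)"

text \<open>Probability of an event about the pair (X,Y) with X, Y independent,
X ~ G(n,p1), Y ~ G(n,p2).\<close>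
definition pair_prob :: "nat \<Rightarrow> real \<Rightarrow> real \<Rightarrow> (nat set set \<Rightarrow> nat set set \<Rightarrow> bool) \<Rightarrow> real" where
  "pair_prob n p1 p2 P =
     (\<Sum>GX\<in>graphs n. \<Sum>GY\<in>graphs n. if P GX GY then gnp_prob n p1 GX * gnp_prob n p2 GY else 0)"

text \<open>Vertices of FS(X,Y): bijections of {0..<n} to itself (the vertex sets of
X and Y are both {0..<n}), represented as permutations fixing everything outside.\<close>
definition FS_vertices :: "nat \<Rightarrow> (nat \<Rightarrow> nat) set" where
  "FS_vertices n = {\<sigma>. \<sigma> permutes {..<n}}"

definition FS_adj :: "nat set set \<Rightarrow> nat set set \<Rightarrow> (nat \<Rightarrow> nat) \<Rightarrow> (nat \<Rightarrow> nat) \<Rightarrow> bool" where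
  "FS_adj GX GY \<sigma> \<sigma>' \<longleftrightarrow>
     (\<exists>a b. {a, b} \<in> GX \<and> {\<sigma> a, \<sigma> b} \<in> GY \<and>
        \<sigma>' a = \<sigma> b \<and> \<sigma>' b = \<sigma> a \<and> (\<forall>c. c \<noteq> a \<and> c \<noteq> b \<longrightarrow> \<sigma>' c = \<sigma> c))"

text \<open>Connectedness of FS(X,Y): any two vertices joined by a path of adjacent vertices.\<close>
definition FS_connected :: "nat \<Rightarrow> nat set set \<Rightarrow> nat set set \<Rightarrow> bool" where
  "FS_connected n GX GY \<longleftrightarrow>
     (\<forall>\<sigma>\<in>FS_vertices n. \<forall>\<tau>\<in>FS_vertices n.
        (\<sigma>, \<tau>) \<in> {(u, v). u \<in> FS_vertices n \<and> v \<in> FS_vertices n \<and> FS_adj GX GY u v}\<^sup>*)"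

definition whp :: "(nat \<Rightarrow> real) \<Rightarrow> bool" where
  "whp P \<longleftrightarrow> P \<longlonglongrightarrow> 1"

definition p0 :: "nat \<Rightarrow> real" where
  "p0 n = exp (2 * ln (real n) powr (2/3)) / sqrt (real n)"

end

theory Submission
  imports Defs "HOL-Library.FuncSet" "HOL-Real_Asymp.Real_Asymp"
begin

text \<open>Disconnectedness: if one graph has an isolated vertex, a token is frozen (second moment method); and if
  \<open>2 \<Delta>(X) \<Delta>(Y) < n\<close>, which Chernoff's bound gives in the sparse case, then by Sauer and Spencer the two
  graphs can be placed edge-disjointly, which is an isolated vertex of \<open>FS(X, Y)\<close>.

  Connectedness only uses \<open>p\<^sub>i \<ge> 300 log n / \<surd>n\<close>. With high probability, for \<^emph>\<open>every\<close> arrangement \<open>\<sigma>\<close> there is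
  a person \<open>r\<close> such that the places \<open>P\<close> occupied by friends of \<open>r\<close> expand in \<open>X\<close>: every small set of places
  has many neighbours in \<open>P\<close>. Walking \<open>r\<close> around as the blank of a 15-puzzle then realises all permutations
  on \<open>P\<close>, as in Wilson's theorem. Given two persons \<open>u\<close>, \<open>v\<close>, each is joined in \<open>Y\<close> by a path of length
  two to \<open>r\<close> or to a friend of \<open>r\<close>; adding the persons on these paths to the puzzle one after the other, each new one
  being moved with the help of its predecessor, one can exchange \<open>u\<close> and \<open>v\<close> and restore everything else.\<close>

section \<open>The puzzle with one hub\<close>

text \<open>The obstacle is that a hub must exist for all n! arrangements at once, so the failure
  probability for a fixed \<sigma> has to be well below 1/n!. No property of a prescribed person is
  that reliable: for small p a given r is isolated in Y with probability (1-p)^(n-1), far more than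
  1/n!. Hence the hub is chosen after \<sigma> and without regard to the two persons u, v to be
  exchanged: that all n candidates fail has roughly the n-th power of a single failure probability.
  The price is that u and v are usually not friends of the hub and have to be linked to it.

  The scale log n / sqrt n comes from one parameter m, about sqrt n / 5. Disjoint sets of size m
  must have an edge between them, which asks for p m above a multiple of log n; sets of up to 4 m +
  10 vertices must expand by the factor m, which asks for n above a multiple of m^2.\<close>

text \<open>Connectedness is phrased through cuts because expansion produces edges across cuts
  directly; paths are replaced by the induction rule that follows.\<close>

definition cut_connected :: "('a \<Rightarrow> 'a \<Rightarrow> bool) \<Rightarrow> 'a set \<Rightarrow> bool" where
  "cut_connected E T \<longleftrightarrow> (\<forall>A\<subseteq>T. A \<noteq> {} \<longrightarrow> A \<noteq> T \<longrightarrow> (\<exists>a\<in>A. \<exists>b\<in>T - A. E a b))"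

lemma cut_connected_induct [consumes 3, case_names start step]:
  assumes "cut_connected E T" "a \<in> T" "c \<in> T"
    and "P a" "\<And>b c. b \<in> T \<Longrightarrow> c \<in> T \<Longrightarrow> P b \<Longrightarrow> E b c \<Longrightarrow> P c"
  shows "P c"
proof (rule ccontr)
  assume "\<not> P c"
  let ?A = "{b \<in> T. P b}"
  have "?A \<subseteq> T" "?A \<noteq> {}" "?A \<noteq> T" using assms(2,3,4) \<open>\<not> P c\<close> by auto
  then obtain b d where "b \<in> ?A" "d \<in> T - ?A" "E b d"
    using assms(1) unfolding cut_connected_def by meson
  then show False using assms(5)[of b d] by auto
qed

text \<open>\<open>hub_walk E T h \<kappa> q\<close>: a hub walking inside \<open>T\<close> from \<open>h\<close> to \<open>q\<close> and swapping with the token at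
  every vertex it enters turns an arrangement \<open>\<sigma>\<close> of tokens into \<open>\<sigma> \<circ> \<kappa>\<close>.\<close>
inductive hub_walk :: "('a \<Rightarrow> 'a \<Rightarrow> bool) \<Rightarrow> 'a set \<Rightarrow> 'a \<Rightarrow> ('a \<Rightarrow> 'a) \<Rightarrow> 'a \<Rightarrow> bool"
  for E T h where
  start: "h \<in> T \<Longrightarrow> hub_walk E T h id h"
| step: "hub_walk E T h \<kappa> q \<Longrightarrow> E q c \<Longrightarrow> c \<in> T \<Longrightarrow> hub_walk E T h (\<kappa> \<circ> transpose q c) c"

lemma hub_walk_in: "hub_walk E T h \<kappa> q \<Longrightarrow> h \<in> T \<and> q \<in> T"
  by (induction rule: hub_walk.induct) auto

lemma hub_walk_permutes: "hub_walk E T h \<kappa> q \<Longrightarrow> \<kappa> permutes T"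
proof (induction rule: hub_walk.induct)
  case (step \<kappa> q c)
  then have "q \<in> T" using hub_walk_in by metis
  then show ?case using step permutes_compose permutes_swap_id by metis
qed (simp add: permutes_id[unfolded id_def])

text \<open>The token that ends at q is the hub itself, which started at h.\<close>

lemma hub_walk_end: "hub_walk E T h \<kappa> q \<Longrightarrow> \<kappa> q = h"
  by (induction rule: hub_walk.induct) auto

text \<open>Arrangements are changed by composition on the right, so the later walk is the right
  factor.\<close>

lemma hub_walk_trans:
  assumes "hub_walk E T q \<kappa>' q'" "hub_walk E T h \<kappa> q"
  shows "hub_walk E T h (\<kappa> \<circ> \<kappa>') q'"
  using assms
proof (induction rule: hub_walk.induct)
  case (step \<kappa>' q' c)
  then show ?case using hub_walk.step[of E T h "\<kappa> \<circ> \<kappa>'" q' c] by (simp add: comp_def)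
qed (simp add: comp_def)

lemma hub_walk_edge: "E h c \<Longrightarrow> h \<in> T \<Longrightarrow> c \<in> T \<Longrightarrow> hub_walk E T h (transpose h c) c"
  using hub_walk.step[OF hub_walk.start] by fastforce

lemma hub_walk_sym:
  assumes "hub_walk E T h \<kappa> q" "symp E"
  shows "hub_walk E T q (inv \<kappa>) h"
  using assms
proof (induction rule: hub_walk.induct)
  case start
  then show ?case using hub_walk.start[of h T E] by (metis inv_id)
next
  case (step \<kappa> q c)
  have "hub_walk E T c (transpose c q) q"
    by (rule hub_walk_edge) (use step hub_walk_in[OF step(1)] sympD[OF step(5)] in auto)
  then have "hub_walk E T c (transpose c q \<circ> inv \<kappa>) h"
    by (rule hub_walk_trans[rotated]) (use step in blast)
  moreover have "inv (\<kappa> \<circ> transpose q c) = transpose c q \<circ> inv \<kappa>"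
    using hub_walk_permutes[OF step(1)]
    by (subst o_inv_distrib) (simp_all add: permutes_bij transpose_commute[of c q])
  ultimately show ?case by (simp add: comp_def)
qed

lemma hub_walk_mono: "hub_walk E T h \<kappa> q \<Longrightarrow> T \<subseteq> T' \<Longrightarrow> hub_walk E T' h \<kappa> q"
  by (induction rule: hub_walk.induct) (auto intro: hub_walk.intros)

lemma hub_walk_exists:
  assumes "cut_connected E T" "h \<in> T" "c \<in> T"
  shows "\<exists>\<kappa>. hub_walk E T h \<kappa> c"
  using assms
proof (induction rule: cut_connected_induct)
  case start
  then show ?case using hub_walk.start assms(2) by metis
next
  case (step b c)
  then show ?case using hub_walk.step by metis
qed

section \<open>Carrying chosen tokens to chosen places\<close>

text \<open>Vertex connectivity greater than k, without the customary lower bound on the size of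
  T.\<close>

definition robust :: "('a \<Rightarrow> 'a \<Rightarrow> bool) \<Rightarrow> nat \<Rightarrow> 'a set \<Rightarrow> bool" where
  "robust E k T \<longleftrightarrow> (\<forall>S\<subseteq>T. card S \<le> k \<longrightarrow> cut_connected E (T - S))"

lemma robustD: "robust E k T \<Longrightarrow> S \<subseteq> T \<Longrightarrow> card S \<le> k \<Longrightarrow> cut_connected E (T - S)"
  unfolding robust_def by auto

text \<open>To push the token from b to a neighbour c, the hub travels to c while avoiding b and the
  protected set S, then steps onto b. Avoiding b in addition to two places of S is what calls for
  \<open>robust E 3 T\<close>.\<close>

lemma hub_walk_carry_token:
  assumes E: "symp E" "irreflp E" and "finite T" "robust E 3 T" "S \<subseteq> T" "card S \<le> 2"
    and "h \<in> T - S" "a \<in> T - S" "a \<noteq> h" "c \<in> T - S"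
  shows "\<exists>\<kappa> q. hub_walk E (T - S) h \<kappa> q \<and> \<kappa> c = a"
proof -
  have "cut_connected E (T - S)" using robustD[OF assms(4,5)] assms(6) by linarith
  then show ?thesis using \<open>a \<in> T - S\<close> \<open>c \<in> T - S\<close>
  proof (induction rule: cut_connected_induct)
    case start
    then show ?case using hub_walk.start[of h "T - S" E] assms(7) by (metis id_apply)
  next
    case (step b c)
    then obtain \<kappa> q where k: "hub_walk E (T - S) h \<kappa> q" "\<kappa> b = a" by auto
    have q: "\<kappa> q = h" "q \<in> T - S" using hub_walk_end hub_walk_in k by metis+
    have "q \<noteq> b" "c \<noteq> b" using q k assms(9) step E(2) by (auto simp: irreflp_def)
    have "finite S" using assms finite_subset by metis
    then have "cut_connected E (T - insert b S)"
      using robustD[OF assms(4), of "insert b S"] assms step by (auto simp: card_insert_if)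
    then obtain \<kappa>1 where k1: "hub_walk E (T - insert b S) q \<kappa>1 c"
      using hub_walk_exists[of E "T - insert b S" q c] q step \<open>q \<noteq> b\<close> \<open>c \<noteq> b\<close> by auto
    have "\<kappa>1 b = b" using hub_walk_permutes[OF k1] by (simp add: permutes_def)
    have "hub_walk E (T - S) q \<kappa>1 c" using hub_walk_mono[OF k1] by auto
    then have "hub_walk E (T - S) h (\<kappa> \<circ> \<kappa>1) c" using hub_walk_trans k by metis
    moreover have "E c b" using step E(1) sympD by metis
    ultimately have "hub_walk E (T - S) h (\<kappa> \<circ> \<kappa>1 \<circ> transpose c b) b"
      using hub_walk.step step by metis
    moreover have "(\<kappa> \<circ> \<kappa>1 \<circ> transpose c b) c = a" using \<open>\<kappa>1 b = b\<close> k by simp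
    ultimately show ?case by blast
  qed
qed

text \<open>The tokens are placed one at a time, each placed one being protected from then on; at
  last the hub walks to q around all three.\<close>

lemma hub_walk_carry_three:
  assumes E: "symp E" "irreflp E" and T: "finite T" "robust E 3 T"
    and a: "distinct [h, a1, a2, a3]" "{h, a1, a2, a3} \<subseteq> T"
    and c: "distinct [q, c1, c2, c3]" "{q, c1, c2, c3} \<subseteq> T"
  shows "\<exists>\<kappa>. hub_walk E T h \<kappa> q \<and> \<kappa> c1 = a1 \<and> \<kappa> c2 = a2 \<and> \<kappa> c3 = a3"
proof -
  obtain \<kappa>1 q1 where 1: "hub_walk E T h \<kappa>1 q1" "\<kappa>1 c1 = a1"
    using hub_walk_carry_token[OF E T, of "{}" h a1 c1] a c by auto
  have p1: "\<kappa>1 permutes T" "\<kappa>1 q1 = h" "q1 \<in> T"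
    using hub_walk_permutes hub_walk_end hub_walk_in 1 by metis+
  \<comment> \<open>The earlier walk may have displaced the second token: this is where it stands
    now.\<close>
  define b2 where "b2 = inv \<kappa>1 a2"
  have b2: "\<kappa>1 b2 = a2" "b2 \<in> T"
    unfolding b2_def using p1(1) a by (auto simp: permutes_inverses permutes_in_image[OF permutes_inv])
  have "b2 \<noteq> c1" "b2 \<noteq> q1" "q1 \<noteq> c1" using b2 1 p1 a by auto
  then obtain \<kappa>2 q2 where 2: "hub_walk E (T - {c1}) q1 \<kappa>2 q2" "\<kappa>2 c2 = b2"
    using hub_walk_carry_token[OF E T, of "{c1}" q1 b2 c2] a c p1 b2 by auto
  have p2: "\<kappa>2 permutes (T - {c1})" "\<kappa>2 q2 = q1" "q2 \<in> T - {c1}"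
    using hub_walk_permutes hub_walk_end hub_walk_in 2 by metis+
  have p2': "\<kappa>2 permutes T" using p2 permutes_subset by blast
  have f2: "\<kappa>2 c1 = c1" using p2 by (simp add: permutes_def)
  define \<kappa> where "\<kappa> = \<kappa>1 \<circ> \<kappa>2"
  have k: "\<kappa> permutes T" unfolding \<kappa>_def using p1 p2' permutes_compose by blast
  have k12: "\<kappa> c1 = a1" "\<kappa> c2 = a2" "\<kappa> q2 = h" unfolding \<kappa>_def using f2 1 2 b2 p1 p2 by auto
  have w2: "hub_walk E T h \<kappa> q2" unfolding \<kappa>_def
    using hub_walk_trans[OF hub_walk_mono[OF 2(1)] 1(1)] by auto
  define b3 where "b3 = inv \<kappa> a3"
  have b3: "\<kappa> b3 = a3" "b3 \<in> T"
    unfolding b3_def using k a by (auto simp: permutes_inverses permutes_in_image[OF permutes_inv])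
  have "b3 \<noteq> c1" "b3 \<noteq> c2" "b3 \<noteq> q2" "q2 \<noteq> c1" "q2 \<noteq> c2" using b3 k12 a by auto
  then obtain \<kappa>3 q3 where 3: "hub_walk E (T - {c1, c2}) q2 \<kappa>3 q3" "\<kappa>3 c3 = b3"
    using hub_walk_carry_token[OF E T, of "{c1, c2}" q2 b3 c3] a c p2 b3 by auto
  have p3: "\<kappa>3 permutes (T - {c1, c2})" "\<kappa>3 q3 = q2" "q3 \<in> T - {c1, c2}"
    using hub_walk_permutes hub_walk_end hub_walk_in 3 by metis+
  have f3: "\<kappa>3 c1 = c1" "\<kappa>3 c2 = c2" using p3 by (auto simp: permutes_def)
  have "q3 \<noteq> c3" using 3 p3 \<open>b3 \<noteq> q2\<close> by auto
  have "cut_connected E (T - {c1, c2, c3})"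
    by (rule robustD[OF T(2)]) (use c in auto)
  then obtain \<kappa>4 where 4: "hub_walk E (T - {c1, c2, c3}) q3 \<kappa>4 q"
    using hub_walk_exists[of E "T - {c1, c2, c3}" q3 q] p3 c \<open>q3 \<noteq> c3\<close> by auto
  have f4: "\<kappa>4 c1 = c1" "\<kappa>4 c2 = c2" "\<kappa>4 c3 = c3"
    using hub_walk_permutes[OF 4] by (auto simp: permutes_def)
  have "hub_walk E T h (\<kappa> \<circ> \<kappa>3 \<circ> \<kappa>4) q"
    using hub_walk_trans[OF hub_walk_mono[OF 4] hub_walk_trans[OF hub_walk_mono[OF 3(1)] w2]] by auto
  moreover have "(\<kappa> \<circ> \<kappa>3 \<circ> \<kappa>4) c1 = a1" "(\<kappa> \<circ> \<kappa>3 \<circ> \<kappa>4) c2 = a2" "(\<kappa> \<circ> \<kappa>3 \<circ> \<kappa>4) c3 = a3"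
    using f3 f4 k12 3 b3 by auto
  ultimately show ?thesis by blast
qed

section \<open>Three-cycles from commutators\<close>

text \<open>On distinct arguments this sends x to y, y to z and z to x.\<close>

definition cycle3 :: "'a \<Rightarrow> 'a \<Rightarrow> 'a \<Rightarrow> 'a \<Rightarrow> 'a" where
  "cycle3 x y z = transpose x y \<circ> transpose y z"

lemma conj_cycle3:
  assumes "bij \<kappa>"
  shows "\<kappa> \<circ> cycle3 x y z \<circ> inv \<kappa> = cycle3 (\<kappa> x) (\<kappa> y) (\<kappa> z)"
proof -
  have t: "\<kappa> (transpose a b (inv \<kappa> w)) = transpose (\<kappa> a) (\<kappa> b) w" for a b w
    using assms unfolding transpose_def
    by (smt (verit) bij_inv_eq_iff)
  show ?thesis
  proof
    fix w
    have "(\<kappa> \<circ> cycle3 x y z \<circ> inv \<kappa>) w = \<kappa> (transpose x y (inv \<kappa> (\<kappa> (transpose y z (inv \<kappa> w)))))"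
      using assms by (simp add: cycle3_def bij_is_inj)
    then show "(\<kappa> \<circ> cycle3 x y z \<circ> inv \<kappa>) w = cycle3 (\<kappa> x) (\<kappa> y) (\<kappa> z) w"
      by (simp add: t cycle3_def)
  qed
qed

text \<open>By \<open>supp\<close> the supports of a and b meet in c alone. Then b fixes
  \<open>a c\<close> and a fixes \<open>b c\<close>, and at every other point besides c the moves in
  the commutator cancel.\<close>

lemma commutator_cycle3:
  assumes "bij a" "bij b" and supp: "\<And>x. x \<noteq> c \<Longrightarrow> a x = x \<or> b x = x"
    and ac: "a c \<noteq> c" and bc: "b c \<noteq> c"
  shows "a \<circ> b \<circ> inv a \<circ> inv b = cycle3 c (a c) (b c)"
    and "distinct [c, a c, b c]"
proof -
  have ia: "inv a x = y \<longleftrightarrow> a y = x" and ib: "inv b x = y \<longleftrightarrow> b y = x" for x y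
    using assms(1,2) bij_inv_eq_iff by metis+
  have ja: "a x = a y \<longleftrightarrow> x = y" and jb: "b x = b y \<longleftrightarrow> x = y" for x y
    using assms(1,2) by (simp_all add: bij_is_inj inj_eq)
  have fb: "b (a c) = a c" using supp[of "a c"] ac ja by blast
  have fa: "a (b c) = b c" using supp[of "b c"] bc jb by blast
  show d: "distinct [c, a c, b c]"
  proof -
    have "a c \<noteq> b c" using fa fb ja ac by metis
    then show ?thesis using ac bc by auto
  qed
  show "a \<circ> b \<circ> inv a \<circ> inv b = cycle3 c (a c) (b c)"
  proof
    fix x
    consider "x = c" | "x = a c" | "x = b c" | "x \<noteq> c" "x \<noteq> a c" "x \<noteq> b c" by blast
    then show "(a \<circ> b \<circ> inv a \<circ> inv b) x = cycle3 c (a c) (b c) x"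
    proof cases
      case 1
      define y where "y = inv b c"
      have y: "b y = c" using ib y_def by metis
      then have "y \<noteq> c" "b y \<noteq> y" using bc by auto
      then have "a y = y" using supp by metis
      then have "inv a y = y" using ia by metis
      then show ?thesis using 1 y d by (simp add: cycle3_def y_def[symmetric])
    next
      case 2
      have "inv b (a c) = a c" "inv a (a c) = c" using fb ia ib by metis+
      then show ?thesis using 2 fa d by (auto simp: cycle3_def transpose_def)
    next
      case 3
      have ibc: "inv b (b c) = c" using ib by metis
      define y where "y = inv a c"
      have y: "a y = c" using ia y_def by metis
      then have "y \<noteq> c" "a y \<noteq> y" using ac by auto
      then have "b y = y" using supp by metis
      then show ?thesis using 3 y d ibc by (simp add: cycle3_def y_def[symmetric])
    next
      case 4
      have rhs: "cycle3 c (a c) (b c) x = x" using 4 by (simp add: cycle3_def transpose_def)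
      show ?thesis
      proof (cases "b x = x")
        case True
        then have i: "inv b x = x" using ib by metis
        define y where "y = inv a x"
        have y: "a y = x" using ia y_def by metis
        then have "y \<noteq> c" using 4 by auto
        then have "b y = y" using supp y True by metis
        then show ?thesis using rhs i y by (simp add: y_def[symmetric])
      next
        case False
        define y where "y = inv b x"
        have y: "b y = x" using ib y_def by metis
        then have "y \<noteq> c" "b y \<noteq> y" using 4 False by auto
        then have "a y = y" using supp by metis
        then have "inv a y = y" using ia by metis
        moreover have "a x = x" using supp 4 False by metis
        ultimately show ?thesis using rhs y by (simp add: y_def[symmetric])
      qed
    qed
  qed
qed

lemma hub_walk_path:
  assumes "successively E (v # w # vs)" "distinct (v # w # vs)"
  shows "\<exists>\<kappa>. hub_walk E (set (v # w # vs)) v \<kappa> (last (w # vs)) \<and> \<kappa> v = w"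
  using assms
proof (induction vs arbitrary: v w)
  case Nil
  then show ?case by (intro exI[of _ "transpose v w"]) (auto intro!: hub_walk_edge)
next
  case (Cons x vs)
  then obtain \<kappa> where k: "hub_walk E (set (w # x # vs)) w \<kappa> (last (x # vs))" by fastforce
  have "\<kappa> v = v" using hub_walk_permutes[OF k] Cons by (auto simp: permutes_def)
  have "hub_walk E (set (v # w # x # vs)) w \<kappa> (last (x # vs))"
    by (rule hub_walk_mono[OF k]) auto
  moreover have "hub_walk E (set (v # w # x # vs)) v (transpose v w) w"
    using Cons by (auto intro!: hub_walk_edge)
  ultimately have "hub_walk E (set (v # w # x # vs)) v (transpose v w \<circ> \<kappa>) (last (x # vs))"
    using hub_walk_trans by metis
  moreover have "(transpose v w \<circ> \<kappa>) v = w" using \<open>\<kappa> v = v\<close> by simp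
  ultimately show ?case by (metis last_ConsR list.discI)
qed

text \<open>A full round brings the hub home and rotates the other tokens of the cycle by one place;
  only the value at the last vertex is recorded, since the commutator argument asks for no
  more.\<close>

lemma hub_walk_cycle:
  assumes "successively E (v # w # vs)" "distinct (v # w # vs)" "E (last (w # vs)) v"
  shows "\<exists>\<kappa>. hub_walk E (set (v # w # vs)) v \<kappa> v \<and> \<kappa> (last (w # vs)) = w"
proof -
  obtain \<kappa> where k: "hub_walk E (set (v # w # vs)) v \<kappa> (last (w # vs))" "\<kappa> v = w"
    using hub_walk_path[OF assms(1,2)] by auto
  have "hub_walk E (set (v # w # vs)) v (\<kappa> \<circ> transpose (last (w # vs)) v) v"
    using hub_walk.step[OF k(1) assms(3)] by auto
  then show ?thesis using k(2) by (intro exI[of _ "\<kappa> \<circ> transpose (last (w # vs)) v"]) auto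
qed

text \<open>The start of a longest path has all its neighbours on the path, hence lies on two cycles that share
  a single edge; the rotations of these two cycles have a 3-cycle as commutator.\<close>
lemma hub_walk_cycle3_exists:
  assumes E: "symp E" "irreflp E" and T: "finite T" "T \<noteq> {}"
    and deg: "\<And>v. v \<in> T \<Longrightarrow> 3 \<le> card {w \<in> T. E v w}"
  shows "\<exists>h x y z. hub_walk E T h (cycle3 x y z) h \<and> distinct [h, x, y, z] \<and> {h, x, y, z} \<subseteq> T"
proof -
  define path where "path xs \<longleftrightarrow> xs \<noteq> [] \<and> distinct xs \<and> successively E xs \<and> set xs \<subseteq> T" for xs
  obtain v0 where "v0 \<in> T" using T by auto
  then have "path [v0]" by (simp add: path_def)
  moreover have "\<forall>xs. path xs \<longrightarrow> length xs < Suc (card T)"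
    using T(1) by (metis card_mono distinct_card le_imp_less_Suc path_def)
  ultimately obtain xs where xs: "path xs" and max: "\<And>ys. path ys \<Longrightarrow> length ys \<le> length xs"
    using ex_has_greatest_nat[of path "[v0]" length "Suc (card T)"] by auto
  define v where "v = hd xs"
  have v: "v \<in> T" "xs ! 0 = v" using xs unfolding path_def v_def by (auto simp: hd_conv_nth)
  have nbr: "w \<in> set xs" if "w \<in> T" "E v w" for w
  proof (rule ccontr)
    assume "w \<notin> set xs"
    then have "path (w # xs)"
      using that xs E(1) unfolding path_def v_def by (cases xs) (auto dest: sympD)
    then show False using max[of "w # xs"] by simp
  qed
  define I where "I = {i. i < length xs \<and> E v (xs ! i)}"
  have "finite I" unfolding I_def by auto
  have "{w \<in> T. E v w} \<subseteq> (!) xs ` I"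
  proof
    fix w assume "w \<in> {w \<in> T. E v w}"
    then obtain i where "i < length xs" "xs ! i = w" "E v w" using nbr by (auto simp: in_set_conv_nth)
    then show "w \<in> (!) xs ` I" unfolding I_def by auto
  qed
  then have "3 \<le> card I"
    using deg[OF v(1)] surj_card_le[OF \<open>finite I\<close>] by (meson le_trans)
  moreover have "0 \<notin> I" using v E(2) by (simp add: I_def irreflp_def)
  \<comment> \<open>Index 0 is v itself, and index 1 is discarded because closing the path at its
    second vertex gives no cycle; two indices i < j with i >= 2 remain.\<close>
  ultimately have c: "1 < card (I - {1})" using \<open>finite I\<close> by (auto simp: card_Diff_singleton_if)
  then obtain i j where ij: "i \<in> I - {1}" "j \<in> I - {1}" "i < j"
    using card_le_Suc0_iff_eq[of "I - {1}"] \<open>finite I\<close>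
    by (metis One_nat_def finite_Diff leD linorder_neqE_nat)
  have i: "2 \<le> i" "i < j" "j < length xs" "E v (xs ! i)" "E v (xs ! j)"
  proof -
    have "i \<noteq> 0" "i \<noteq> 1" using ij \<open>0 \<notin> I\<close> by (metis DiffE, simp)
    then show "2 \<le> i" by simp
  qed (use ij I_def in auto)
  have succ: "successively E xs" and dist: "distinct xs" and sub: "set xs \<subseteq> T"
    using xs by (auto simp: path_def)
  \<comment> \<open>The cycles are x_0, ..., x_i and x_0, x_i, ..., x_j. They share the edge from v
    = x_0 to x_i, but v is the home of the hub and fixed by both rotations, so x_i is the only point
    moved by both.\<close>
  define P where "P = take (Suc i) xs"
  define R where "R = drop i (take (Suc j) xs)"
  have lenP: "length P = Suc i" and lenR: "length R = Suc (j - i)" using i by (auto simp: P_def R_def)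
  have nthP: "P ! k = xs ! k" if "k \<le> i" for k using that by (simp add: P_def)
  have nthR: "R ! k = xs ! (i + k)" if "k \<le> j - i" for k using that i by (simp add: R_def)
  obtain w ps where P: "P = v # w # ps"
    using lenP i(1) v nthP[of 0] by (metis Suc_le_length_iff Suc_le_mono Suc_1 le_0_eq nat_le_linear nth_Cons_0 Suc_leD)
  have lastP: "last (w # ps) = xs ! i" using P lenP nthP[of i] last_conv_nth[of P] by auto
  have sP: "successively E P" "distinct P" unfolding P_def
    using succ dist by (simp_all add: successively_conv_nth)
  obtain \<kappa>a where a: "hub_walk E (set P) v \<kappa>a v" "\<kappa>a (xs ! i) = w"
    using hub_walk_cycle[of E v w ps] sP lastP i(4) E(1) P by (auto dest: sympD)
  obtain rs where R: "R = xs ! i # rs" using lenR nthR[of 0] by (cases R) auto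
  have "rs \<noteq> []" using R lenR i by auto
  have lastR: "last R = xs ! j" using lenR nthR[of "j - i"] last_conv_nth[of R] i R by auto
  have "successively E R"
    using succ lenR nthR i by (simp add: successively_conv_nth)
  moreover have "distinct R" unfolding R_def using dist by simp
  ultimately have sR: "successively E R" "distinct R" .
  have vR: "v \<notin> set R"
  proof
    assume "v \<in> set R"
    then obtain k where "k \<le> j - i" "R ! k = v" using lenR by (auto simp: in_set_conv_nth less_Suc_eq_le)
    then have "xs ! (i + k) = xs ! 0" using nthR v by auto
    moreover have "i + k < length xs" "0 < length xs" using i \<open>k \<le> j - i\<close> by linarith+
    ultimately have "i + k = 0" using dist nth_eq_iff_index_eq by blast
    then show False using i by simp
  qed
  obtain \<kappa>b where b: "hub_walk E (set (v # R)) v \<kappa>b v" "\<kappa>b (xs ! j) = xs ! i"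
    using hub_walk_cycle[of E v "xs ! i" rs] sR lastR vR i(4,5) E(1) R by (auto dest: sympD)
  have PT: "set P \<subseteq> T" using sub set_take_subset unfolding P_def by fast
  have RT: "set R \<subseteq> T" using sub set_take_subset set_drop_subset unfolding R_def by fast
  have pa: "\<kappa>a permutes set P" and pb: "\<kappa>b permutes set (v # R)"
    using a b hub_walk_permutes by metis+
  have fixv: "\<kappa>a v = v" "\<kappa>b v = v" using a b hub_walk_end by metis+
  have wi: "w \<noteq> xs ! i"
  proof -
    have "w = xs ! 1" using P nthP[of 1] i by simp
    moreover have "1 < length xs" "i < length xs" "1 \<noteq> i" using i by linarith+
    ultimately show ?thesis using dist nth_eq_iff_index_eq by metis
  qed
  have wa: "\<kappa>a (xs ! i) \<noteq> xs ! i" using a wi by simp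
  have wb: "\<kappa>b (xs ! i) \<noteq> xs ! i"
  proof
    assume "\<kappa>b (xs ! i) = xs ! i"
    then have "xs ! i = xs ! j" using b(2) pb by (metis permutes_inj injD)
    moreover have "i < length xs" using i by linarith
    ultimately show False using dist i nth_eq_iff_index_eq[of xs i j] by auto
  qed
  have inter: "x = xs ! i" if x: "x \<in> set P" "x \<in> set R" for x
  proof -
    obtain k l where "k \<le> i" "xs ! k = x" "l \<le> j - i" "xs ! (i + l) = x"
      using x lenP lenR nthP nthR by (auto simp: in_set_conv_nth less_Suc_eq_le)
    moreover from this have "i + l < length xs" "k < length xs" using i by linarith+
    ultimately have "k = i + l" using dist nth_eq_iff_index_eq by metis
    then show ?thesis using \<open>k \<le> i\<close> \<open>xs ! k = x\<close> by auto
  qed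
  have supp: "\<kappa>a x = x \<or> \<kappa>b x = x" if "x \<noteq> xs ! i" for x
    using inter[of x] that permutes_not_in[OF pa, of x] permutes_not_in[OF pb, of x] fixv
    by (cases "x = v"; cases "x \<in> set P"; cases "x \<in> set R") auto
  have bij: "bij \<kappa>a" "bij \<kappa>b" using pa pb permutes_bij by blast+
  note comm = commutator_cycle3[OF bij supp wa wb]
  have wa': "hub_walk E T v \<kappa>a v" and wb': "hub_walk E T v \<kappa>b v"
    using hub_walk_mono[OF a(1) PT] hub_walk_mono[OF b(1)] RT v by auto
  have "hub_walk E T v (\<kappa>a \<circ> \<kappa>b \<circ> inv \<kappa>a \<circ> inv \<kappa>b) v"
    using hub_walk_trans[OF hub_walk_sym[OF wb' E(1)] hub_walk_trans[OF hub_walk_sym[OF wa' E(1)]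
      hub_walk_trans[OF wb' wa']]] .
  then have "hub_walk E T v (cycle3 (xs ! i) (\<kappa>a (xs ! i)) (\<kappa>b (xs ! i))) v"
    using comm by simp
  moreover have "v \<noteq> xs ! i" using i(4) E(2) by (auto simp: irreflp_def)
  moreover from this have "\<kappa>a (xs ! i) \<noteq> v" "\<kappa>b (xs ! i) \<noteq> v"
    using fixv bij by (metis bij_pointE)+
  moreover have "xs ! i \<in> T" using i sub by auto
  moreover from this have "\<kappa>a (xs ! i) \<in> T" "\<kappa>b (xs ! i) \<in> T"
    using wa' wb' hub_walk_permutes permutes_in_image by metis+
  ultimately show ?thesis using comm(2) v(1) 
    by (intro exI[of _ v] exI[of _ "xs ! i"] exI[of _ "\<kappa>a (xs ! i)"] exI[of _ "\<kappa>b (xs ! i)"]) auto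
qed

text \<open>One 3-cycle yields all: the tokens a1, a2, a3 are carried to its three places, rotated
  there and carried back, which is conjugation by the carrying walk.\<close>

lemma hub_walk_all_cycle3:
  assumes E: "symp E" "irreflp E" and T: "finite T" "robust E 3 T" "5 \<le> card T"
    and a: "distinct [h, a1, a2, a3]" "{h, a1, a2, a3} \<subseteq> T"
  shows "hub_walk E T h (cycle3 a1 a2 a3) h"
proof -
  \<comment> \<open>With at most two neighbours, deleting them would cut v off from the rest of T,
    which is nonempty as T has at least 5 vertices.\<close>
  have "3 \<le> card {w \<in> T. E v w}" if "v \<in> T" for v
  proof (rule ccontr)
    let ?N = "{w \<in> T. E v w}"
    assume "\<not> 3 \<le> card ?N"
    then have conn: "cut_connected E (T - ?N)" by (intro robustD[OF T(2)]) auto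
    have "card (T - ?N) \<ge> 2" using \<open>\<not> 3 \<le> card ?N\<close> T(1,3) by (subst card_Diff_subset) auto
    then have "T - ?N \<noteq> {v}" by (metis card.empty card_insert_disjoint empty_iff finite.emptyI One_nat_def not_less_eq_eq numeral_2_eq_2 order_refl)
    moreover have "v \<in> T - ?N" using that E(2) by (auto simp: irreflp_def)
    ultimately show False using conn unfolding cut_connected_def by (elim allE[of _ "{v}"]) auto
  qed
  moreover have "T \<noteq> {}" using a by auto
  ultimately obtain q x y z where 3: "hub_walk E T q (cycle3 x y z) q" "distinct [q, x, y, z]" "{q, x, y, z} \<subseteq> T"
    using hub_walk_cycle3_exists[OF E T(1)] by auto
  obtain \<kappa> where k: "hub_walk E T h \<kappa> q" "\<kappa> x = a1" "\<kappa> y = a2" "\<kappa> z = a3"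
    using hub_walk_carry_three[OF E T(1,2) a 3(2,3)] by auto
  have "hub_walk E T h (\<kappa> \<circ> cycle3 x y z \<circ> inv \<kappa>) h"
    by (intro hub_walk_trans[OF hub_walk_sym[OF k(1) E(1)]] hub_walk_trans[OF 3(1)] k)
  then show ?thesis
    using conj_cycle3[of \<kappa> x y z] hub_walk_permutes[OF k(1)] k permutes_bij by metis
qed

section \<open>Parity and the full symmetric group\<close>

definition bipartition :: "('a \<Rightarrow> 'a \<Rightarrow> bool) \<Rightarrow> 'a set \<Rightarrow> 'a set \<Rightarrow> bool" where
  "bipartition E T A \<longleftrightarrow> (\<forall>b\<in>T. \<forall>c\<in>T. E b c \<longrightarrow> (b \<in> A \<longleftrightarrow> c \<notin> A))"

text \<open>Every step contributes one transposition, so the sign of a walk is the parity of its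
  length. If all closed walks were even, the parity of the walks from h to a vertex would be well
  defined and would colour T properly with two colours.\<close>

lemma hub_walk_odd:
  assumes E: "symp E" "irreflp E" and T: "finite T" "cut_connected E T" "h \<in> T"
    and nonbip: "\<And>A. \<not> bipartition E T A"
  shows "\<exists>\<kappa>. hub_walk E T h \<kappa> h \<and> \<not> evenperm \<kappa>"
proof (rule ccontr)
  assume "\<not> ?thesis"
  then have even: "evenperm \<kappa>" if "hub_walk E T h \<kappa> h" for \<kappa> using that by blast
  have perm: "permutation \<kappa>" if "hub_walk E T h \<kappa> c" for \<kappa> c
    using that hub_walk_permutes T(1) permutation_permutes by metis
  have uniq: "evenperm \<kappa> = evenperm \<kappa>'" if w: "hub_walk E T h \<kappa> c" "hub_walk E T h \<kappa>' c" for \<kappa> \<kappa>' c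
  proof -
    have "hub_walk E T h (\<kappa> \<circ> inv \<kappa>') h" using w hub_walk_trans hub_walk_sym E(1) by metis
    then show ?thesis
      using even evenperm_comp[OF perm[OF w(1)] permutation_inverse[OF perm[OF w(2)]]]
        evenperm_inv[OF perm[OF w(2)]] by metis
  qed
  define A where "A = {c. \<exists>\<kappa>. hub_walk E T h \<kappa> c \<and> evenperm \<kappa>}"
  have "bipartition E T A"
    unfolding bipartition_def
  proof (intro ballI impI)
    fix b c assume bc: "b \<in> T" "c \<in> T" "E b c"
    obtain \<kappa> where k: "hub_walk E T h \<kappa> b" using hub_walk_exists T bc by metis
    have k': "hub_walk E T h (\<kappa> \<circ> transpose b c) c" using hub_walk.step k bc by metis
    have "b \<noteq> c" using bc E(2) by (auto simp: irreflp_def)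
    then have "evenperm (\<kappa> \<circ> transpose b c) \<longleftrightarrow> \<not> evenperm \<kappa>"
      by (simp add: evenperm_comp[OF perm[OF k] permutation_swap_id] evenperm_swap)
    moreover have "b \<in> A \<longleftrightarrow> evenperm \<kappa>" unfolding A_def using k uniq by blast
    moreover have "c \<in> A \<longleftrightarrow> evenperm (\<kappa> \<circ> transpose b c)" unfolding A_def using k' uniq by blast
    ultimately show "b \<in> A \<longleftrightarrow> c \<notin> A" by blast
  qed
  then show False using nonbip by auto
qed

text \<open>The classical step by which 3-cycles generate the alternating group; in the disjoint
  case \<open>transpose b c\<close> is inserted twice.\<close>

lemma transpose_product_cycle3:
  assumes "a \<noteq> b" "c \<noteq> d"
  shows "transpose a b \<circ> transpose c d = id
    \<or> (\<exists>x y z. distinct [x, y, z] \<and> {x, y, z} \<subseteq> {a, b, c, d} \<and> transpose a b \<circ> transpose c d = cycle3 x y z)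
    \<or> (distinct [a, b, c, d] \<and> transpose a b \<circ> transpose c d = cycle3 a b c \<circ> cycle3 b c d)"
proof -
  have 1: "transpose a b \<circ> transpose b d = cycle3 a b d" for a b d :: 'a by (simp add: cycle3_def)
  consider "{a, b} = {c, d}" | "b = c" "a \<noteq> d" | "b = d" "a \<noteq> c" | "a = c" "b \<noteq> d" | "a = d" "b \<noteq> c"
    | "distinct [a, b, c, d]" using assms by auto
  then show ?thesis
  proof cases
    case 1
    then show ?thesis by (auto simp: doubleton_eq_iff transpose_commute)
  next
    case 2
    then show ?thesis using 1[of a b d] assms by (intro disjI2 disjI1 exI[of _ a] exI[of _ b] exI[of _ d]) auto
  next
    case 3
    then show ?thesis using 1[of a b c] assms
      by (intro disjI2 disjI1 exI[of _ a] exI[of _ b] exI[of _ c]) (auto simp: transpose_commute)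
  next
    case 4
    then show ?thesis using 1[of b a d] assms
      by (intro disjI2 disjI1 exI[of _ b] exI[of _ a] exI[of _ d]) (auto simp: transpose_commute)
  next
    case 5
    then show ?thesis using 1[of b a c] assms
      by (intro disjI2 disjI1 exI[of _ b] exI[of _ a] exI[of _ c]) (auto simp: transpose_commute)
  next
    case 6
    have "cycle3 a b c \<circ> cycle3 b c d = transpose a b \<circ> (transpose b c \<circ> transpose b c) \<circ> transpose c d"
      by (simp only: cycle3_def comp_assoc)
    then show ?thesis using 6 by simp
  qed
qed

lemma hub_walk_all_fixing:
  assumes E: "symp E" "irreflp E" and T: "finite T" "robust E 3 T" "5 \<le> card T" "h \<in> T"
    and nonbip: "\<And>A. \<not> bipartition E T A"
    and p: "p permutes T - {h}"
  shows "hub_walk E T h p h"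
proof -
  let ?G = "\<lambda>p. hub_walk E T h p h"
  have mult: "?G (p \<circ> q)" if "?G p" "?G q" for p q using that hub_walk_trans by metis
  have id: "?G id" using hub_walk.start T(4) by metis
  have two: "?G (transpose a b \<circ> transpose c d)"
    if ab: "a \<in> T - {h}" "b \<in> T - {h}" "c \<in> T - {h}" "d \<in> T - {h}" "a \<noteq> b" "c \<noteq> d" for a b c d
  proof -
    have c3: "?G (cycle3 x y z)" if "distinct [x, y, z]" "{x, y, z} \<subseteq> {a, b, c, d}" for x y z
      using that ab T(4) by (intro hub_walk_all_cycle3[OF E T(1,2,3)]) auto
    from transpose_product_cycle3[OF ab(5,6)] show ?thesis
    proof (elim disjE exE conjE)
      assume "transpose a b \<circ> transpose c d = id"
      then show ?thesis using id by metis
    next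
      fix x y z assume "distinct [x, y, z]" "{x, y, z} \<subseteq> {a, b, c, d}" "transpose a b \<circ> transpose c d = cycle3 x y z"
      then show ?thesis using c3 by metis
    next
      assume d: "distinct [a, b, c, d]" and e: "transpose a b \<circ> transpose c d = cycle3 a b c \<circ> cycle3 b c d"
      have "?G (cycle3 a b c)" "?G (cycle3 b c d)" using d by (auto intro!: c3)
      then show ?thesis using mult e by metis
    qed
  qed
  \<comment> \<open>For odd p the claim allows one extra transposition of arbitrary choice. Thus in
    the induction an even p picks up two transpositions, covered by \<open>two\<close>, and an odd p
    exactly the one it is allowed.\<close>
  have key: "(evenperm p \<longrightarrow> ?G p) \<and> (\<not> evenperm p \<longrightarrow> (\<forall>a\<in>T - {h}. \<forall>b\<in>T - {h}. a \<noteq> b \<longrightarrow> ?G (transpose a b \<circ> p)))"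
    if "p permutes T - {h}" for p
  proof -
    have "finite (T - {h})" using T(1) by auto
    with that show ?thesis
    proof (induction rule: permutes_induct)
      case id
      then show ?case using \<open>?G id\<close> by (auto simp: evenperm_id id_def)
    next
      case (swap a b p)
      show ?case
      proof (cases "a = b")
        case False
        have "permutation p" using swap(4) T(1) by (metis finite_Diff permutation_permutes)
        then have ev: "evenperm (transpose a b \<circ> p) \<longleftrightarrow> \<not> evenperm p"
          using False by (simp add: evenperm_comp permutation_swap_id evenperm_swap)
        show ?thesis
        proof (cases "evenperm p")
          case True
          have "?G (transpose c d \<circ> (transpose a b \<circ> p))" if "c \<in> T - {h}" "d \<in> T - {h}" "c \<noteq> d" for c d
            using mult[OF two[OF that(1,2) swap(1,2) that(3) False], of p] swap(5) True by (simp add: comp_assoc)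
          then show ?thesis using ev True by blast
        next
          case odd: False
          then have "?G (transpose a b \<circ> p)" using swap False by blast
          then show ?thesis using ev odd by blast
        qed
      qed (use swap in simp)
    qed
  qed
  have "cut_connected E T" using robustD[OF T(2), of "{}"] by simp
  \<comment> \<open>An odd closed walk w passes from the alternating to the symmetric group: a
    transposition times w is even, and walking w backwards afterwards leaves the
    transposition.\<close>
  then obtain w where w: "?G w" "\<not> evenperm w" using hub_walk_odd[OF E T(1) _ T(4) nonbip] by auto
  have wp: "w permutes T - {h}"
    using hub_walk_permutes[OF w(1)] hub_walk_end[OF w(1)] by (auto simp: permutes_def)
  have swap: "?G (transpose a b)" if "a \<in> T - {h}" "b \<in> T - {h}" "a \<noteq> b" for a b
  proof -
    have "?G (transpose a b \<circ> w)" using key[OF wp] w that by blast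
    then have "?G ((transpose a b \<circ> w) \<circ> inv w)" using mult hub_walk_sym[OF w(1) E(1)] by metis
    then show ?thesis using permutes_inv_o(1)[OF wp] by (simp add: comp_assoc)
  qed
  show ?thesis
  proof (cases "evenperm p")
    case False
    have "permutation p" using p T(1) by (metis finite_Diff permutation_permutes)
    then have "p \<noteq> id" using False evenperm_id by metis
    then obtain a where "p a \<noteq> a" by fastforce
    then have a: "a \<in> T - {h}" "p a \<in> T - {h}" using p by (auto simp: permutes_def permutes_in_image[OF p])
    then have "?G (transpose a (p a) \<circ> p)" using key[OF p] False \<open>p a \<noteq> a\<close> by metis
    then have "?G (transpose a (p a) \<circ> (transpose a (p a) \<circ> p))" using mult swap[OF a] \<open>p a \<noteq> a\<close> by metis
    then show ?thesis by (simp add: comp_assoc[symmetric])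
  qed (use key p in auto)
qed

text \<open>The last place of the hub is forced by \<open>hub_walk_end\<close>. Any walk to it
  reduces the claim to a permutation that fixes the hub.\<close>

theorem hub_walk_all:
  assumes E: "symp E" "irreflp E" and T: "finite T" "robust E 3 T" "5 \<le> card T" "h \<in> T"
    and nonbip: "\<And>A. \<not> bipartition E T A"
    and p: "p permutes T"
  shows "hub_walk E T h p (inv p h)"
proof -
  let ?q = "inv p h"
  have q: "?q \<in> T" "p ?q = h" using p T(4) by (auto simp: permutes_inverses permutes_in_image[OF permutes_inv[OF p]])
  have "cut_connected E T" using robustD[OF T(2), of "{}"] by simp
  then obtain \<kappa> where k: "hub_walk E T h \<kappa> ?q" using hub_walk_exists T(4) q by metis
  note kp = hub_walk_permutes[OF k]
  have "(inv \<kappa> \<circ> p) permutes T" using permutes_compose[OF p permutes_inv[OF kp]] .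
  moreover have "(inv \<kappa> \<circ> p) ?q = ?q" using q hub_walk_end[OF k] kp by (simp add: permutes_inv_eq)
  ultimately have "(inv \<kappa> \<circ> p) permutes T - {?q}" by (auto simp: permutes_def)
  then have "hub_walk E T ?q (inv \<kappa> \<circ> p) ?q"
    using hub_walk_all_fixing[OF E T(1,2,3) q(1) nonbip] by blast
  then have "hub_walk E T h (\<kappa> \<circ> (inv \<kappa> \<circ> p)) ?q" using hub_walk_trans k by metis
  then show ?thesis using permutes_inv_o(1)[OF kp] by (simp add: comp_assoc[symmetric])
qed

section \<open>Exchanging two persons\<close>

definition gadj :: "nat set set \<Rightarrow> nat \<Rightarrow> nat \<Rightarrow> bool" where
  "gadj G a b \<longleftrightarrow> {a, b} \<in> G"

lemma graphsD: "G \<in> graphs n \<Longrightarrow> {a, b} \<in> G \<Longrightarrow> a < n \<and> b < n \<and> a \<noteq> b"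
  unfolding graphs_def all_edges_def by (fastforce simp: doubleton_eq_iff)

lemma symp_gadj: "symp (gadj G)"
  by (auto simp: symp_def gadj_def insert_commute)

lemma irreflp_gadj: "G \<in> graphs n \<Longrightarrow> irreflp (gadj G)"
  using graphsD[of G n] by (intro irreflpI) (auto simp: gadj_def simp del: insert_absorb2)

locale friends_strangers =
  fixes n :: nat and X Y :: "nat set set"
  assumes X: "X \<in> graphs n" and Y: "Y \<in> graphs n"
begin

definition reach :: "(nat \<Rightarrow> nat) \<Rightarrow> (nat \<Rightarrow> nat) \<Rightarrow> bool" where
  "reach \<sigma> \<tau> \<longleftrightarrow> (\<sigma>, \<tau>) \<in> {(u, v). u \<in> FS_vertices n \<and> v \<in> FS_vertices n \<and> FS_adj X Y u v}\<^sup>*"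

lemma reach_refl: "reach \<sigma> \<sigma>"
  unfolding reach_def by simp

lemma reach_trans: "reach \<sigma> \<tau> \<Longrightarrow> reach \<tau> \<upsilon> \<Longrightarrow> reach \<sigma> \<upsilon>"
  unfolding reach_def by (rule rtrancl_trans)

lemma reach_swap:
  assumes "\<sigma> permutes {..<n}" "{a, b} \<in> X" "{\<sigma> a, \<sigma> b} \<in> Y"
  shows "reach \<sigma> (\<sigma> \<circ> transpose a b)"
proof -
  have "a < n" "b < n" using graphsD[OF X assms(2)] by auto
  then have "\<sigma> \<circ> transpose a b permutes {..<n}"
    using assms(1) permutes_compose permutes_swap_id by (metis lessThan_iff)
  moreover have "FS_adj X Y \<sigma> (\<sigma> \<circ> transpose a b)"
    unfolding FS_adj_def by (rule exI[of _ a], rule exI[of _ b]) (use assms in auto)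
  ultimately show ?thesis unfolding reach_def FS_vertices_def using assms(1) by auto
qed

section \<open>Regions in which all permutations are reachable\<close>

definition full :: "(nat \<Rightarrow> nat) \<Rightarrow> nat set \<Rightarrow> bool" where
  "full \<sigma> T \<longleftrightarrow> (\<forall>\<pi>. \<pi> permutes T \<longrightarrow> reach \<sigma> (\<sigma> \<circ> \<pi>))"

lemma permutes_comp_sub:
  "\<sigma> permutes {..<n} \<Longrightarrow> \<pi> permutes T \<Longrightarrow> T \<subseteq> {..<n} \<Longrightarrow> \<sigma> \<circ> \<pi> permutes {..<n}"
  using permutes_compose permutes_subset by blast

text \<open>The hub is the person \<sigma> h, a friend of everybody else in T. Hence each step along
  an edge of X is a legal swap, whoever happens to stand on the vertex entered.\<close>

lemma reach_hub_walk:
  assumes "hub_walk (gadj X) T h \<kappa> q" "T \<subseteq> {..<n}" "\<sigma> permutes {..<n}"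
    and friends: "\<And>c. c \<in> T \<Longrightarrow> c \<noteq> h \<Longrightarrow> {\<sigma> h, \<sigma> c} \<in> Y"
  shows "reach \<sigma> (\<sigma> \<circ> \<kappa>)"
  using assms(1)
proof (induction rule: hub_walk.induct)
  case start
  then show ?case by (simp add: reach_refl comp_def)
next
  case (step \<kappa> q c)
  have k: "\<kappa> permutes T" "\<kappa> q = h" using step hub_walk_permutes hub_walk_end by metis+
  have "q \<noteq> c" using step(2) irreflp_gadj[OF X] by (auto simp: irreflp_def)
  then have "\<kappa> c \<noteq> h" using k by (metis permutes_inj injD)
  moreover have "\<kappa> c \<in> T" using k step by (metis permutes_in_image)
  ultimately have "{\<sigma> (\<kappa> q), \<sigma> (\<kappa> c)} \<in> Y" using friends k by auto
  then have "reach (\<sigma> \<circ> \<kappa>) (\<sigma> \<circ> \<kappa> \<circ> transpose q c)"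
    using step(2) permutes_comp_sub[OF assms(3) k(1) assms(2)] by (intro reach_swap) (auto simp: gadj_def)
  then have "reach \<sigma> (\<sigma> \<circ> \<kappa> \<circ> transpose q c)" using step.IH reach_trans by (metis comp_def)
  then show ?case by (simp add: comp_def)
qed

lemma full_hub:
  assumes "robust (gadj X) 3 T" "5 \<le> card T" "T \<subseteq> {..<n}" "h \<in> T"
    and nonbip: "\<And>A. \<not> bipartition (gadj X) T A"
    and "\<sigma> permutes {..<n}" and friends: "\<And>c. c \<in> T \<Longrightarrow> c \<noteq> h \<Longrightarrow> {\<sigma> h, \<sigma> c} \<in> Y"
  shows "full \<sigma> T"
  unfolding full_def
proof (intro allI impI)
  fix \<pi> assume "\<pi> permutes T"
  then have "hub_walk (gadj X) T h \<pi> (inv \<pi> h)"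
    using assms finite_subset[OF assms(3)] by (intro hub_walk_all symp_gadj irreflp_gadj[OF X]) auto
  then show "reach \<sigma> (\<sigma> \<circ> \<pi>)" using assms by (intro reach_hub_walk)
qed

text \<open>\<open>\<Theta>\<close> contains the tokens allowed in the region and \<open>\<Delta>\<close> those that must be present.\<close>
definition full_family :: "nat set \<Rightarrow> nat \<Rightarrow> nat set \<Rightarrow> nat set \<Rightarrow> bool" where
  "full_family Q k \<Theta> \<Delta> \<longleftrightarrow> (\<forall>\<sigma> T. \<sigma> permutes {..<n} \<longrightarrow> T \<subseteq> Q \<longrightarrow> card (Q - T) \<le> k \<longrightarrow>
     \<sigma> ` T \<subseteq> \<Theta> \<longrightarrow> \<Delta> \<subseteq> \<sigma> ` T \<longrightarrow> full \<sigma> T)"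

lemma full_family_mono:
  "full_family Q k \<Theta> \<Delta> \<Longrightarrow> k' \<le> k \<Longrightarrow> \<Delta> \<subseteq> \<Delta>' \<Longrightarrow> full_family Q k' \<Theta> \<Delta>'"
  unfolding full_family_def by (meson le_trans subset_trans)

text \<open>A token \<open>u\<close> can be walked through the region by repeatedly bringing a friend of \<open>u\<close> next to it.\<close>
lemma full_family_insert:
  assumes full: "full_family Q (Suc k) \<Theta> \<Delta>"
    and Q: "Q \<subseteq> {..<n}" "robust (gadj X) (Suc k) Q"
    and "\<Delta> \<subseteq> \<Theta>" "s \<in> \<Delta>" "{s, u} \<in> Y"
  shows "full_family Q k (insert u \<Theta>) \<Delta>"
proof (cases "u \<in> \<Theta>")
  case True
  then show ?thesis using full_family_mono[OF full, of k \<Delta>] by (simp add: insert_absorb)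
next
  case False
  show ?thesis
    unfolding full_family_def full_def
  proof (intro allI impI)
    fix \<sigma> T \<pi>
    assume \<sigma>: "\<sigma> permutes {..<n}" and T: "T \<subseteq> Q" "card (Q - T) \<le> k" and \<Theta>: "\<sigma> ` T \<subseteq> insert u \<Theta>"
      and \<Delta>: "\<Delta> \<subseteq> \<sigma> ` T" and \<pi>: "\<pi> permutes T"
    have Tn: "T \<subseteq> {..<n}" and fin: "finite Q" using T Q finite_subset by auto
    note full' = full[unfolded full_family_def full_def, rule_format]
    show "reach \<sigma> (\<sigma> \<circ> \<pi>)"
    proof (cases "u \<in> \<sigma> ` T")
      case False
      then show ?thesis using full'[OF \<sigma> T(1) _ _ \<Delta> \<pi>] T(2) \<Theta> by auto
    next
      case True
      then obtain a where a: "a \<in> T" "\<sigma> a = u" by auto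
      have inj: "inj \<sigma>" using \<sigma> permutes_inj by auto
      \<comment> \<open>Giving up the place of u uses one more of the places of Q that a region may
        lack, hence \<open>Suc k\<close> in the hypothesis.\<close>
      have card1: "card (Q - (T - {b})) \<le> Suc k" for b
      proof -
        have "Q - (T - {b}) \<subseteq> insert b (Q - T)" by auto
        then have "card (Q - (T - {b})) \<le> card (insert b (Q - T))" using fin by (intro card_mono) auto
        also have "\<dots> \<le> Suc k" using T(2) card_insert_le_m1[of "Suc k" "Q - T" b] by auto
        finally show ?thesis .
      qed
      \<comment> \<open>While u rests at b, the remaining region \<open>T - {b}\<close> holds only
        tokens of \<Theta>, so \<open>full\<close> rearranges it at will. It still contains
        \<Delta>, because u is not in \<Theta> and therefore not in \<Delta>.\<close>
      have local_full: "reach (\<sigma> \<circ> \<kappa>) (\<sigma> \<circ> \<kappa> \<circ> \<rho>)"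
        if \<kappa>: "\<kappa> permutes T" "\<sigma> (\<kappa> b) = u" and b: "b \<in> T" and \<rho>: "\<rho> permutes T - {b}" for \<kappa> \<rho> b
      proof (rule full'[of _ "T - {b}"])
        show "\<sigma> \<circ> \<kappa> permutes {..<n}" using \<sigma> \<kappa> Tn permutes_comp_sub by blast
        have im: "(\<sigma> \<circ> \<kappa>) ` (T - {b}) = \<sigma> ` T - {u}"
        proof -
          have "inj (\<sigma> \<circ> \<kappa>)" using inj permutes_inj[OF \<kappa>(1)] by (simp add: inj_compose)
          then have "(\<sigma> \<circ> \<kappa>) ` (T - {b}) = (\<sigma> \<circ> \<kappa>) ` T - (\<sigma> \<circ> \<kappa>) ` {b}" by (rule image_set_diff)
          also have "(\<sigma> \<circ> \<kappa>) ` T = \<sigma> ` T" using permutes_image[OF \<kappa>(1)] by (metis image_comp)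
          finally show ?thesis using \<kappa>(2) by simp
        qed
        show "(\<sigma> \<circ> \<kappa>) ` (T - {b}) \<subseteq> \<Theta>" using im \<Theta> by auto
        show "\<Delta> \<subseteq> (\<sigma> \<circ> \<kappa>) ` (T - {b})" using im \<Delta> False assms(4) by auto
        show "card (Q - (T - {b})) \<le> Suc k" by (rule card1)
      qed (use T \<rho> in auto)
      have "cut_connected (gadj X) (Q - (Q - T))" using T by (intro robustD[OF Q(2)]) auto
      moreover have "Q - (Q - T) = T" using T by auto
      ultimately have conn: "cut_connected (gadj X) T" by simp
      have move: "\<exists>\<kappa>. \<kappa> permutes T \<and> reach \<sigma> (\<sigma> \<circ> \<kappa>) \<and> \<sigma> (\<kappa> c) = u" if "c \<in> T" for c
        using conn a(1) that
      proof (induction rule: cut_connected_induct)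
        case start
        then show ?case using a reach_refl permutes_id[of T] by (intro exI[of _ id]) (auto simp: id_def)
      next
        case (step b c)
        then obtain \<kappa> where \<kappa>: "\<kappa> permutes T" "reach \<sigma> (\<sigma> \<circ> \<kappa>)" "\<sigma> (\<kappa> b) = u"
          by (auto simp: comp_def)
        have "s \<in> \<sigma> ` T" using \<Delta> assms(5) by auto
        then have "s \<in> (\<sigma> \<circ> \<kappa>) ` T" using permutes_image[OF \<kappa>(1)] by (metis image_comp)
        then obtain d where d: "d \<in> T" "\<sigma> (\<kappa> d) = s" by auto
        have "s \<noteq> u" using graphsD[OF Y assms(6)] by auto
        then have "d \<noteq> b" using d \<kappa> by auto
        have "c \<noteq> b" using step irreflp_gadj[OF X] by (auto simp: irreflp_def)
        \<comment> \<open>\<rho> brings the friend s to c without touching u at b; then s and u are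
          swapped along the edge from b to c.\<close>
        define \<rho> where "\<rho> = transpose c d"
        have \<rho>: "\<rho> permutes T - {b}" unfolding \<rho>_def
          using d \<open>d \<noteq> b\<close> \<open>c \<noteq> b\<close> step by (intro permutes_swap_id) auto
        have 1: "reach (\<sigma> \<circ> \<kappa>) (\<sigma> \<circ> \<kappa> \<circ> \<rho>)" using local_full \<kappa> step \<rho> by blast
        have \<rho>': "\<kappa> \<circ> \<rho> permutes T" using \<kappa>(1) \<rho> permutes_compose permutes_subset by (metis Diff_subset)
        have b: "\<sigma> (\<kappa> (\<rho> b)) = u" "\<sigma> (\<kappa> (\<rho> c)) = s"
          using \<kappa> d \<open>d \<noteq> b\<close> \<open>c \<noteq> b\<close> by (auto simp: \<rho>_def transpose_def)
        have "reach (\<sigma> \<circ> (\<kappa> \<circ> \<rho>)) (\<sigma> \<circ> (\<kappa> \<circ> \<rho>) \<circ> transpose b c)"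
          using step b assms(6) permutes_comp_sub[OF \<sigma> \<rho>' Tn]
          by (intro reach_swap) (auto simp: gadj_def insert_commute)
        then have "reach \<sigma> (\<sigma> \<circ> (\<kappa> \<circ> \<rho> \<circ> transpose b c))"
          using reach_trans[OF reach_trans[OF \<kappa>(2) 1]] by (simp add: comp_assoc)
        moreover have "\<kappa> \<circ> \<rho> \<circ> transpose b c permutes T"
          using \<rho>' permutes_swap_id[of b T c] step permutes_compose by blast
        moreover have "\<sigma> ((\<kappa> \<circ> \<rho> \<circ> transpose b c) c) = u" using b by simp
        ultimately show ?case by blast
      qed
      \<comment> \<open>The place where \<pi> wants u. Once u is there, the rest of \<pi> takes
        place in \<open>T - {c}\<close>.\<close>
      define c where "c = inv \<pi> a"
      have c: "\<pi> c = a" "c \<in> T"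
        using \<pi> a by (auto simp: c_def permutes_inverses permutes_in_image[OF permutes_inv[OF \<pi>]])
      obtain \<kappa> where \<kappa>: "\<kappa> permutes T" "reach \<sigma> (\<sigma> \<circ> \<kappa>)" "\<sigma> (\<kappa> c) = u" using move c by blast
      have "\<kappa> c = a" using \<kappa>(3) a inj by (metis injD)
      have "(inv \<kappa> \<circ> \<pi>) c = c" using c \<open>\<kappa> c = a\<close> \<kappa>(1) by (simp add: permutes_inv_eq)
      moreover have "inv \<kappa> \<circ> \<pi> permutes T" using permutes_compose[OF \<pi> permutes_inv[OF \<kappa>(1)]] .
      ultimately have "inv \<kappa> \<circ> \<pi> permutes T - {c}" by (auto simp: permutes_def)
      then have "reach (\<sigma> \<circ> \<kappa>) (\<sigma> \<circ> \<kappa> \<circ> (inv \<kappa> \<circ> \<pi>))" using local_full \<kappa> c by blast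
      moreover have "\<sigma> \<circ> \<kappa> \<circ> (inv \<kappa> \<circ> \<pi>) = \<sigma> \<circ> \<pi>"
        using permutes_inv_o(1)[OF \<kappa>(1)] by (metis comp_assoc comp_id)
      ultimately show ?thesis using reach_trans \<kappa>(2) by metis
    qed
  qed
qed

end

section \<open>Expansion, bipartite holes and the exchange\<close>

definition neighbours :: "nat set set \<Rightarrow> nat set \<Rightarrow> nat set" where
  "neighbours G A = {h. \<exists>g\<in>A. {g, h} \<in> G}"

text \<open>No bipartite hole of size m. It serves cuts with two large sides, where expansion of
  small sets says nothing.\<close>

definition joined :: "nat \<Rightarrow> nat set set \<Rightarrow> nat \<Rightarrow> bool" where
  "joined n G m \<longleftrightarrow> (\<forall>A B. A \<subseteq> {..<n} \<longrightarrow> B \<subseteq> {..<n} \<longrightarrow> A \<inter> B = {} \<longrightarrow> m \<le> card A \<longrightarrow> m \<le> card B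
     \<longrightarrow> (\<exists>a\<in>A. \<exists>b\<in>B. {a, b} \<in> G))"

definition expanding :: "nat \<Rightarrow> nat set set \<Rightarrow> nat \<Rightarrow> nat \<Rightarrow> bool" where
  "expanding n G M d \<longleftrightarrow> (\<forall>A\<subseteq>{..<n}. A \<noteq> {} \<longrightarrow> card A \<le> M \<longrightarrow> d * card A \<le> card (neighbours G A - A))"

text \<open>The number 8 leaves one neighbour after the removal of up to 4 places of special tokens and of 3 more
  places, as needed by the puzzle.\<close>
definition good_hub :: "nat \<Rightarrow> nat set set \<Rightarrow> nat set set \<Rightarrow> nat \<Rightarrow> (nat \<Rightarrow> nat) \<Rightarrow> nat \<Rightarrow> bool" where
  "good_hub n X Y M \<sigma> r \<longleftrightarrow> (\<forall>A\<subseteq>{..<n}. A \<noteq> {} \<longrightarrow> card A \<le> M \<longrightarrow>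
     8 \<le> card (neighbours X A \<inter> {h. {\<sigma> h, r} \<in> Y} - A))"

context friends_strangers
begin

lemma neighbours_sub: "G \<in> graphs n \<Longrightarrow> neighbours G A \<subseteq> {..<n}"
  by (auto simp: neighbours_def dest: graphsD)

text \<open>A side of at most M places has 8 neighbours at places of friends of r, and one of them
  survives 7 deletions. If both sides are larger, both have at least m places and
  \<open>joined\<close> gives the crossing edge.\<close>

lemma good_hub_robust:
  assumes J: "good_hub n X Y M \<sigma> r" and E: "joined n X m" "m \<le> M"
    and Q: "{h. {\<sigma> h, r} \<in> Y} \<inter> {..<n} \<subseteq> Q" "Q \<subseteq> {..<n}"
  shows "robust (gadj X) 7 Q"
  unfolding robust_def cut_connected_def
proof (intro allI impI)
  fix S A assume S: "S \<subseteq> Q" "card S \<le> 7" and A: "A \<subseteq> Q - S" "A \<noteq> {}" "A \<noteq> Q - S"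
  let ?B = "Q - S - A"
  have fin: "finite Q" using Q(2) finite_subset by auto
  have out: "\<exists>h\<in>Q - S - C. \<exists>g\<in>C. {g, h} \<in> X" if C: "C \<subseteq> Q - S" "C \<noteq> {}" "card C \<le> M" for C
  proof -
    let ?H = "neighbours X C \<inter> {h. {\<sigma> h, r} \<in> Y} - C"
    have "8 \<le> card ?H" using J C Q(2) unfolding good_hub_def by blast
    moreover have HQ: "?H \<subseteq> Q" using Q(1) neighbours_sub[OF X] by blast
    moreover have "\<not> ?H \<subseteq> S"
      using card_mono[of S ?H] finite_subset[OF S(1) fin] \<open>8 \<le> card ?H\<close> S(2) by auto
    ultimately obtain h where "h \<in> ?H" "h \<notin> S" by blast
    then show ?thesis using HQ unfolding neighbours_def by blast
  qed
  consider "card A \<le> M" | "card ?B \<le> M" | "m \<le> card A" "m \<le> card ?B" using E(2) by linarith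
  then show "\<exists>a\<in>A. \<exists>b\<in>Q - S - A. gadj X a b"
  proof cases
    case 1
    then show ?thesis using out[of A] A unfolding gadj_def by blast
  next
    case 2
    have "?B \<noteq> {}" using A by auto
    then obtain h g where "h \<in> Q - S - ?B" "g \<in> ?B" "{g, h} \<in> X" using out[of ?B] 2 by blast
    then have "h \<in> A" "{h, g} \<in> X" by (auto simp: insert_commute)
    then show ?thesis using \<open>g \<in> ?B\<close> unfolding gadj_def by blast
  next
    case 3
    then show ?thesis
      using E(1)[unfolded joined_def, rule_format, of A ?B] A Q(2) unfolding gadj_def by blast
  qed
qed

text \<open>One colour class would have at least 2 m vertices, and two disjoint subsets of size m of
  that class are joined by an edge inside it.\<close>

lemma joined_not_bipartition:
  assumes "joined n X m" "T \<subseteq> {..<n}" "4 * m \<le> card T"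
  shows "\<not> bipartition (gadj X) T A"
proof
  assume bip: "bipartition (gadj X) T A"
  have fin: "finite T" using assms finite_subset by auto
  have no: False if C: "C \<subseteq> T" "2 * m \<le> card C" "C \<subseteq> A \<or> C \<inter> A = {}" for C
  proof -
    have finC: "finite C" using C(1) fin finite_subset by auto
    obtain C1 where C1: "C1 \<subseteq> C" "card C1 = m"
      using obtain_subset_with_card_n[of m C] C(2) by auto
    have "m \<le> card (C - C1)" using C1 C(2) finC by (subst card_Diff_subset) (auto intro: finite_subset)
    then obtain a b where "a \<in> C1" "b \<in> C - C1" "{a, b} \<in> X"
      using assms(1)[unfolded joined_def, rule_format, of C1 "C - C1"] C1 C(1) assms(2) by blast
    then show False using bip C C1(1) unfolding bipartition_def gadj_def by blast
  qed
  have "card (T \<inter> A) + card (T - A) = card T"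
    using card_Int_Diff fin by metis
  then have "2 * m \<le> card (T \<inter> A) \<or> 2 * m \<le> card (T - A)" using assms(3) by linarith
  then show False using no[of "T \<inter> A"] no[of "T - A"] by blast
qed

lemma reach_transpose:
  assumes \<sigma>: "\<sigma> permutes {..<n}" and xy: "x < n" "y < n" "x \<noteq> y"
    and J: "r < n" "good_hub n X Y (4 * m + 10) \<sigma> r"
    and E: "joined n X m" "joined n Y m" and N: "expanding n Y (4 * m + 10) m" and m: "2 \<le> m"
  shows "reach \<sigma> (\<sigma> \<circ> transpose x y)"
proof -
  define N where "N = (\<lambda>u. neighbours Y {u})"
  have Nn: "N u \<subseteq> {..<n}" for u unfolding N_def by (rule neighbours_sub[OF Y])
  have N_iff: "z \<in> N u \<longleftrightarrow> {u, z} \<in> Y" for u z by (simp add: N_def neighbours_def)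
  have Nm: "m \<le> card (N u)" if "u < n" for u
  proof -
    have "m * card {u} \<le> card (neighbours Y {u} - {u})"
      using N that unfolding expanding_def by (elim allE[of _ "{u}"]) auto
    also have "\<dots> \<le> card (N u)" unfolding N_def using Nn[of u] finite_subset
      by (intro card_mono) (auto simp: N_def)
    finally show ?thesis by simp
  qed
  define \<Theta> where "\<Theta> = insert r (N r)"
  \<comment> \<open>The neighbourhoods of u and r in Y both have at least m elements. Either they
    share a friend, and then t = r, or they are disjoint and some edge joins them.\<close>
  have link: "\<exists>s t. t \<in> \<Theta> \<and> {t, s} \<in> Y \<and> {s, u} \<in> Y" if u: "u < n" for u
  proof (cases "N u \<inter> N r = {}")
    case True
    then obtain s t where "s \<in> N u" "t \<in> N r" "{s, t} \<in> Y"
      using E(2)[unfolded joined_def, rule_format, of "N u" "N r"] Nn Nm u J(1) by blast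
    then have "t \<in> \<Theta>" "{t, s} \<in> Y" "{s, u} \<in> Y" by (auto simp: \<Theta>_def N_iff insert_commute)
    then show ?thesis by blast
  next
    case False
    then obtain z where "z \<in> N u" "z \<in> N r" by auto
    then have "r \<in> \<Theta>" "{r, z} \<in> Y" "{z, u} \<in> Y" by (auto simp: \<Theta>_def N_iff insert_commute)
    then show ?thesis by blast
  qed
  define u v where "u = \<sigma> x" and "v = \<sigma> y"
  have uv: "u < n" "v < n" using \<sigma> xy unfolding u_def v_def by (auto dest: permutes_in_image)
  obtain s t where st: "t \<in> \<Theta>" "{t, s} \<in> Y" "{s, u} \<in> Y" using link uv by blast
  obtain s' t' where st': "t' \<in> \<Theta>" "{t', s'} \<in> Y" "{s', v} \<in> Y" using link uv by blast
  define \<Psi> where "\<Psi> = insert v (insert u (insert s' (insert s \<Theta>)))"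
  define Q where "Q = {h. h < n \<and> \<sigma> h \<in> \<Psi>}"
  have P: "{h. {\<sigma> h, r} \<in> Y} \<inter> {..<n} \<subseteq> Q"
    unfolding Q_def \<Psi>_def \<Theta>_def by (auto simp: N_iff insert_commute)
  have Qn: "Q \<subseteq> {..<n}" unfolding Q_def by auto
  then have fin: "finite Q" using finite_subset by auto
  have rob: "robust (gadj X) 7 Q"
    using good_hub_robust[OF J(2) E(1) _ P Qn] by simp
  \<comment> \<open>If Q were small, it would have 8 neighbours outside Q at places of friends of r,
    but all those places lie in Q.\<close>
  have cardQ: "4 * m + 10 < card Q"
  proof (rule ccontr)
    assume not: "\<not> 4 * m + 10 < card Q"
    have "Q \<noteq> {}" using xy(1) unfolding Q_def \<Psi>_def u_def by auto
    moreover have "neighbours X Q \<inter> {h. {\<sigma> h, r} \<in> Y} - Q = {}"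
      using P neighbours_sub[OF X] by blast
    ultimately show False
      using J(2)[unfolded good_hub_def, rule_format, of Q] Qn not
      by (metis card.empty le_numeral_extra(2) not_less not_numeral_le_zero)
  qed
  \<comment> \<open>The 7 deletions tolerated by Q split into 4 missing places and the 3 of
    \<open>full_hub\<close>. The size of Q leaves more than 4 m places in T, enough to exclude a
    bipartition.\<close>
  have base: "full_family Q 4 \<Theta> {r}"
    unfolding full_family_def
  proof (intro allI impI)
    fix \<tau> T assume \<tau>: "\<tau> permutes {..<n}" and T: "T \<subseteq> Q" "card (Q - T) \<le> 4" "\<tau> ` T \<subseteq> \<Theta>" "{r} \<subseteq> \<tau> ` T"
    obtain h where h: "h \<in> T" "\<tau> h = r" using T(4) by auto
    have cT: "4 * m + 6 \<le> card T"
    proof -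
      have "card (Q - T) = card Q - card T" using T(1) fin finite_subset by (intro card_Diff_subset) auto
      then show ?thesis using T(2) cardQ by linarith
    qed
    have "robust (gadj X) 3 T"
      unfolding robust_def
    proof (intro allI impI)
      fix S assume S: "S \<subseteq> T" "card S \<le> 3"
      have "card ((Q - T) \<union> S) \<le> 7" using card_Un_le[of "Q - T" S] T(2) S(2) by linarith
      then have "cut_connected (gadj X) (Q - ((Q - T) \<union> S))" using T(1) S(1) by (intro robustD[OF rob]) auto
      moreover have "Q - ((Q - T) \<union> S) = T - S" using T(1) by auto
      ultimately show "cut_connected (gadj X) (T - S)" by simp
    qed
    moreover have "{\<tau> h, \<tau> c} \<in> Y" if "c \<in> T" "c \<noteq> h" for c
    proof -
      have "\<tau> c \<noteq> r" using that h \<tau> by (metis permutes_inj injD)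
      then show ?thesis using T(3) that h unfolding \<Theta>_def N_iff[symmetric] by auto
    qed
    ultimately show "full \<tau> T"
      using T(1) Qn cT h \<tau> joined_not_bipartition[OF E(1), of T] by (intro full_hub[of T h]) auto
  qed
  have robk: "robust (gadj X) k Q" if "k \<le> 7" for k using rob that unfolding robust_def by auto
  have f1: "full_family Q 3 (insert s \<Theta>) {r, t, t'}"
    by (rule full_family_insert[where s = t])
      (use full_family_mono[OF base] st st' Qn robk in \<open>auto simp: \<Theta>_def\<close>)
  have f2: "full_family Q 2 (insert s' (insert s \<Theta>)) {r, t, t'}"
    by (rule full_family_insert[where s = t'])
      (use full_family_mono[OF f1] st st' Qn robk in \<open>auto simp: \<Theta>_def\<close>)
  have f3: "full_family Q 1 (insert u (insert s' (insert s \<Theta>))) {r, t, t', s, s'}"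
    by (rule full_family_insert[where s = s])
      (use full_family_mono[OF f2] st st' Qn robk in \<open>auto simp: \<Theta>_def\<close>)
  have f4: "full_family Q 0 \<Psi> {r, t, t', s, s'}"
    unfolding \<Psi>_def by (rule full_family_insert[where s = s'])
      (use f3 st st' Qn robk in \<open>auto simp: \<Theta>_def\<close>)
  have "\<Psi> \<subseteq> {..<n}"
    using uv Nn J(1) graphsD[OF Y st(2)] graphsD[OF Y st'(2)] unfolding \<Psi>_def \<Theta>_def by auto
  have "\<sigma> ` Q = \<Psi>"
  proof
    show "\<Psi> \<subseteq> \<sigma> ` Q"
    proof
      fix z assume z: "z \<in> \<Psi>"
      then have "z \<in> \<sigma> ` {..<n}" using \<open>\<Psi> \<subseteq> {..<n}\<close> permutes_image[OF \<sigma>] by auto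
      then show "z \<in> \<sigma> ` Q" using z unfolding Q_def by auto
    qed
  qed (auto simp: Q_def)
  then have "full \<sigma> Q"
    using f4[unfolded full_family_def, rule_format, OF \<sigma>, of Q] st(1) st'(1)
    unfolding \<Psi>_def \<Theta>_def by auto
  moreover have "transpose x y permutes Q"
    using xy unfolding Q_def \<Psi>_def u_def v_def by (intro permutes_swap_id) auto
  ultimately show ?thesis unfolding full_def by blast
qed

text \<open>Transpositions generate all permutations, and since \<open>hubs\<close> speaks of every
  arrangement, a new hub can be chosen before each exchange.\<close>

theorem FS_connected_if_good_hubs:
  assumes "joined n X m" "joined n Y m" "expanding n Y (4 * m + 10) m" "2 \<le> m"
    and hubs: "\<And>\<sigma>. \<sigma> permutes {..<n} \<Longrightarrow> \<exists>r<n. good_hub n X Y (4 * m + 10) \<sigma> r"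
  shows "FS_connected n X Y"
proof -
  have swap: "reach \<sigma> (\<sigma> \<circ> transpose x y)" if "\<sigma> permutes {..<n}" "x < n" "y < n" "x \<noteq> y" for \<sigma> x y
    using hubs[OF that(1)] reach_transpose[OF that] assms by blast
  have all: "reach \<sigma> (\<sigma> \<circ> \<pi>)" if "\<pi> permutes {..<n}" "\<sigma> permutes {..<n}" for \<pi> \<sigma>
    using that(1) finite_lessThan that(2)
  proof (induction arbitrary: \<sigma> rule: permutes_induct)
    case id
    then show ?case by (simp add: reach_refl comp_def)
  next
    case (swap a b p)
    have "\<sigma> \<circ> transpose a b permutes {..<n}"
      using swap.hyps swap.prems permutes_compose permutes_swap_id by metis
    then have "reach (\<sigma> \<circ> transpose a b) (\<sigma> \<circ> transpose a b \<circ> p)" using swap.IH by (simp add: comp_def)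
    then have "reach \<sigma> (\<sigma> \<circ> transpose a b \<circ> p)"
      using \<open>\<And>\<sigma> x y. \<lbrakk>\<sigma> permutes {..<n}; x < n; y < n; x \<noteq> y\<rbrakk> \<Longrightarrow> reach \<sigma> (\<sigma> \<circ> transpose x y)\<close>
        swap.hyps swap.prems reach_trans by (metis lessThan_iff)
    then show ?case by (simp add: comp_def)
  qed
  show ?thesis
    unfolding FS_connected_def
  proof (intro ballI)
    fix \<sigma> \<tau> assume "\<sigma> \<in> FS_vertices n" "\<tau> \<in> FS_vertices n"
    then have p: "\<sigma> permutes {..<n}" "\<tau> permutes {..<n}" by (auto simp: FS_vertices_def)
    have "reach \<sigma> (\<sigma> \<circ> (inv \<sigma> \<circ> \<tau>))" using p by (intro all permutes_compose permutes_inv)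
    then have "reach \<sigma> \<tau>" using permutes_inv_o(1)[OF p(1)] by (simp add: comp_assoc[symmetric])
    then show "(\<sigma>, \<tau>) \<in> {(u, v). u \<in> FS_vertices n \<and> v \<in> FS_vertices n \<and> FS_adj X Y u v}\<^sup>*"
      unfolding reach_def .
  qed
qed

end

section \<open>Random graphs\<close>

definition rg_prob :: "nat \<Rightarrow> real \<Rightarrow> (nat set set \<Rightarrow> bool) \<Rightarrow> real" where
  "rg_prob n p P = (\<Sum>G\<in>graphs n. if P G then gnp_prob n p G else 0)"

lemma finite_all_edges: "finite (all_edges n)"
proof -
  have "all_edges n \<subseteq> Pow {..<n}" unfolding all_edges_def by auto
  then show ?thesis using finite_subset by blast
qed

lemma gnp_prob_nonneg: "0 \<le> p \<Longrightarrow> p \<le> 1 \<Longrightarrow> 0 \<le> gnp_prob n p G"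
  unfolding gnp_prob_def by simp

text \<open>The generating function of a binomial edge count, by expanding the product over all
  edges. Empty D gives the total mass, x = 0 the probability of having no edge in D, and x > 1 is
  the moment behind Chernoff's bound.\<close>

lemma gnp_expectation_power:
  fixes p x :: real
  assumes D: "D \<subseteq> all_edges n"
  shows "(\<Sum>G\<in>graphs n. gnp_prob n p G * x ^ card (G \<inter> D)) = (1 - p + p * x) ^ card D"
proof -
  let ?E = "all_edges n"
  let ?f = "\<lambda>e. p * (if e \<in> D then x else 1)" and ?g = "\<lambda>e. 1 - p"
  have "(\<Sum>G\<in>graphs n. gnp_prob n p G * x ^ card (G \<inter> D)) = (\<Sum>G\<in>Pow ?E. prod ?f G * prod ?g (?E - G))"
    unfolding graphs_def
  proof (rule sum.cong[OF refl])
    fix G assume "G \<in> Pow ?E"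
    then have G: "G \<subseteq> ?E" "finite G" using finite_all_edges finite_subset by auto
    have "prod ?f G = p ^ card G * (\<Prod>e\<in>G. if e \<in> D then x else 1)" by (simp add: prod.distrib)
    also have "(\<Prod>e\<in>G. if e \<in> D then x else 1) = x ^ card (G \<inter> D)"
      using G(2) by (simp add: prod.If_cases)
    finally show "gnp_prob n p G * x ^ card (G \<inter> D) = prod ?f G * prod ?g (?E - G)"
      using G finite_all_edges by (simp add: gnp_prob_def card_Diff_subset)
  qed
  also have "\<dots> = (\<Prod>e\<in>?E. ?f e + ?g e)" by (rule prod_add[OF finite_all_edges, symmetric])
  also have "\<dots> = (\<Prod>e\<in>?E. if e \<in> D then 1 - p + p * x else 1)" by (rule prod.cong) auto
  also have "\<dots> = (1 - p + p * x) ^ card D"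
    using D finite_all_edges by (simp add: prod.If_cases Int_absorb1)
  finally show ?thesis .
qed

lemma gnp_prob_sum: "(\<Sum>G\<in>graphs n. gnp_prob n p G) = 1"
proof -
  have "(\<Sum>G\<in>graphs n. gnp_prob n p G) = (\<Sum>G\<in>graphs n. gnp_prob n p G * 1 ^ card (G \<inter> {}))" by simp
  also have "\<dots> = (1 - p + p * 1) ^ card ({} :: nat set set)" by (rule gnp_expectation_power) simp
  finally show ?thesis by simp
qed

lemma rg_prob_no_edges:
  assumes "D \<subseteq> all_edges n"
  shows "rg_prob n p (\<lambda>G. G \<inter> D = {}) = (1 - p) ^ card D"
proof -
  have "(if G \<inter> D = {} then gnp_prob n p G else 0) = gnp_prob n p G * 0 ^ card (G \<inter> D)" if "G \<in> graphs n" for G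
  proof -
    have "finite (G \<inter> D)" using assms finite_all_edges finite_subset by blast
    then show ?thesis by (auto simp: power_0_left)
  qed
  then show ?thesis using gnp_expectation_power[OF assms, of p 0] unfolding rg_prob_def by simp
qed

context
  fixes p :: real
  assumes p: "0 \<le> p" "p \<le> 1"
begin

lemma rg_prob_mono:
  assumes "\<And>G. G \<in> graphs n \<Longrightarrow> P G \<Longrightarrow> Q G"
  shows "rg_prob n p P \<le> rg_prob n p Q"
  unfolding rg_prob_def by (intro sum_mono) (use assms gnp_prob_nonneg[OF p] in auto)

lemma rg_prob_nonneg: "0 \<le> rg_prob n p P"
  unfolding rg_prob_def by (intro sum_nonneg) (use gnp_prob_nonneg[OF p] in auto)

lemma rg_prob_union_bound:
  assumes "finite I" "\<And>G. G \<in> graphs n \<Longrightarrow> P G \<Longrightarrow> \<exists>i\<in>I. Q i G"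
  shows "rg_prob n p P \<le> (\<Sum>i\<in>I. rg_prob n p (Q i))"
proof -
  have "rg_prob n p P \<le> (\<Sum>G\<in>graphs n. \<Sum>i\<in>I. if Q i G then gnp_prob n p G else 0)"
    unfolding rg_prob_def
  proof (intro sum_mono)
    fix G assume G: "G \<in> graphs n"
    show "(if P G then gnp_prob n p G else 0) \<le> (\<Sum>i\<in>I. if Q i G then gnp_prob n p G else 0)"
    proof (cases "P G")
      case True
      then obtain i where i: "i \<in> I" "Q i G" using assms(2) G by blast
      have "gnp_prob n p G = (\<Sum>i\<in>{i}. if Q i G then gnp_prob n p G else 0)" using i by simp
      also have "\<dots> \<le> (\<Sum>i\<in>I. if Q i G then gnp_prob n p G else 0)"
        by (rule sum_mono2) (use i assms(1) gnp_prob_nonneg[OF p] in auto)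
      finally show ?thesis using True by simp
    qed (auto intro!: sum_nonneg gnp_prob_nonneg[OF p])
  qed
  also have "\<dots> = (\<Sum>i\<in>I. rg_prob n p (Q i))" unfolding rg_prob_def by (rule sum.swap)
  finally show ?thesis .
qed

lemma rg_prob_disj: "rg_prob n p (\<lambda>G. P G \<or> Q G) \<le> rg_prob n p P + rg_prob n p Q"
  unfolding rg_prob_def sum.distrib[symmetric]
  by (intro sum_mono) (use gnp_prob_nonneg[OF p] in auto)

lemma rg_prob_no_edges_le:
  assumes "D \<subseteq> all_edges n" "t \<le> real (card D)"
  shows "rg_prob n p (\<lambda>G. G \<inter> D = {}) \<le> exp (- (p * t))"
proof -
  have "rg_prob n p (\<lambda>G. G \<inter> D = {}) = (1 - p) ^ card D" by (rule rg_prob_no_edges[OF assms(1)])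
  also have "\<dots> \<le> exp (- p) ^ card D"
    using exp_ge_add_one_self[of "- p"] p by (intro power_mono) auto
  also have "\<dots> = exp (- (p * real (card D)))" by (simp add: exp_of_nat_mult[symmetric] mult.commute)
  also have "\<dots> \<le> exp (- (p * t))" using assms(2) p by (auto intro: mult_left_mono)
  finally show ?thesis .
qed

end

lemma rg_prob_compl: "rg_prob n p P + rg_prob n p (\<lambda>G. \<not> P G) = 1"
proof -
  have "(if P G then gnp_prob n p G else 0) + (if \<not> P G then gnp_prob n p G else 0) = gnp_prob n p G" for G
    by simp
  then show ?thesis unfolding rg_prob_def sum.distrib[symmetric] by (simp only: gnp_prob_sum)
qed

lemma pair_prob_eq: "pair_prob n p1 p2 P = (\<Sum>X\<in>graphs n. gnp_prob n p1 X * rg_prob n p2 (P X))"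
  unfolding pair_prob_def rg_prob_def sum_distrib_left by (intro sum.cong) auto

lemma pair_prob_compl: "pair_prob n p1 p2 P + pair_prob n p1 p2 (\<lambda>X Y. \<not> P X Y) = 1"
proof -
  have "pair_prob n p1 p2 P + pair_prob n p1 p2 (\<lambda>X Y. \<not> P X Y) = (\<Sum>X\<in>graphs n. gnp_prob n p1 X * (rg_prob n p2 (P X) + rg_prob n p2 (\<lambda>Y. \<not> P X Y)))"
    unfolding pair_prob_eq sum.distrib[symmetric] by (simp add: distrib_left)
  then show ?thesis by (simp add: rg_prob_compl gnp_prob_sum)
qed

text \<open>Conditioning on X: events of one graph are paid for separately, and \<open>C\<close> has
  to be bounded only for X outside \<open>A\<close>, so that bound may rely on typical properties of
  X.\<close>

lemma pair_prob_le:
  assumes p1: "0 \<le> p1" "p1 \<le> 1" and p2: "0 \<le> p2" "p2 \<le> 1"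
    and P: "\<And>X Y. X \<in> graphs n \<Longrightarrow> Y \<in> graphs n \<Longrightarrow> P X Y \<Longrightarrow> A X \<or> B Y \<or> C X Y"
    and C: "\<And>X. X \<in> graphs n \<Longrightarrow> \<not> A X \<Longrightarrow> rg_prob n p2 (C X) \<le> c" and "0 \<le> c"
  shows "pair_prob n p1 p2 P \<le> rg_prob n p1 A + rg_prob n p2 B + c"
proof -
  let ?b = "rg_prob n p2 B"
  have b0: "0 \<le> ?b" by (rule rg_prob_nonneg[OF p2])
  have "gnp_prob n p1 X * rg_prob n p2 (P X) \<le> (if A X then gnp_prob n p1 X else 0) + gnp_prob n p1 X * (?b + c)"
    if X: "X \<in> graphs n" for X
  proof -
    have g0: "0 \<le> gnp_prob n p1 X" by (rule gnp_prob_nonneg[OF p1])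
    show ?thesis
    proof (cases "A X")
      case True
      have "rg_prob n p2 (P X) \<le> 1"
        using rg_prob_compl[of n p2 "P X"] rg_prob_nonneg[OF p2, of n "\<lambda>Y. \<not> P X Y"] by linarith
      then have "gnp_prob n p1 X * rg_prob n p2 (P X) \<le> gnp_prob n p1 X" using g0 by (simp add: mult_left_le)
      moreover have "0 \<le> gnp_prob n p1 X * (?b + c)" using g0 b0 \<open>0 \<le> c\<close> by simp
      ultimately show ?thesis using True by simp
    next
      case False
      have "rg_prob n p2 (P X) \<le> rg_prob n p2 (\<lambda>Y. B Y \<or> C X Y)"
        by (rule rg_prob_mono[OF p2]) (use P X False in blast)
      also have "\<dots> \<le> ?b + c" using rg_prob_disj[OF p2, of n B "C X"] C[OF X False] by linarith
      finally show ?thesis using False g0 by (simp add: mult_left_mono)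
    qed
  qed
  then have "pair_prob n p1 p2 P \<le> (\<Sum>X\<in>graphs n. (if A X then gnp_prob n p1 X else 0) + gnp_prob n p1 X * (?b + c))"
    unfolding pair_prob_eq by (rule sum_mono)
  also have "\<dots> = rg_prob n p1 A + (?b + c)"
    unfolding sum.distrib rg_prob_def[of n p1] by (simp add: sum_distrib_right[symmetric] gnp_prob_sum)
  finally show ?thesis by simp
qed

lemma pair_prob_nonneg:
  assumes "0 \<le> p1" "p1 \<le> 1" "0 \<le> p2" "p2 \<le> 1"
  shows "0 \<le> pair_prob n p1 p2 P"
  unfolding pair_prob_eq using assms by (intro sum_nonneg mult_nonneg_nonneg gnp_prob_nonneg rg_prob_nonneg)

lemma whp_pair_probI:
  assumes p: "\<And>n. 0 \<le> p1 n \<and> p1 n \<le> 1" "\<And>n. 0 \<le> p2 n \<and> p2 n \<le> 1"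
    and ev: "eventually (\<lambda>n. pair_prob n (p1 n) (p2 n) (\<lambda>X Y. \<not> P n X Y) \<le> f n) sequentially"
    and f: "f \<longlonglongrightarrow> 0"
  shows "whp (\<lambda>n. pair_prob n (p1 n) (p2 n) (P n))"
proof -
  have "(\<lambda>n. pair_prob n (p1 n) (p2 n) (\<lambda>X Y. \<not> P n X Y)) \<longlonglongrightarrow> 0"
    by (rule real_tendsto_sandwich[OF _ ev tendsto_const f]) (use p pair_prob_nonneg in simp)
  then have "(\<lambda>n. 1 - pair_prob n (p1 n) (p2 n) (\<lambda>X Y. \<not> P n X Y)) \<longlonglongrightarrow> 1 - 0"
    by (intro tendsto_intros)
  moreover have "1 - pair_prob n (p1 n) (p2 n) (\<lambda>X Y. \<not> P n X Y) = pair_prob n (p1 n) (p2 n) (P n)" for n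
    using pair_prob_compl[of n "p1 n" "p2 n" "P n"] by linarith
  ultimately show ?thesis unfolding whp_def by simp
qed

section \<open>Random graphs contain good hubs\<close>

definition cross :: "nat set \<Rightarrow> nat set \<Rightarrow> nat set set" where
  "cross A B = (\<lambda>(a, b). {a, b}) ` (A \<times> B)"

lemma card_cross: "A \<inter> B = {} \<Longrightarrow> card (cross A B) = card A * card B"
  unfolding cross_def
  by (subst card_image) (auto simp: inj_on_def doubleton_eq_iff card_cartesian_product)

lemma cross_subset: "A \<subseteq> {..<n} \<Longrightarrow> B \<subseteq> {..<n} \<Longrightarrow> A \<inter> B = {} \<Longrightarrow> cross A B \<subseteq> all_edges n"
  unfolding cross_def all_edges_def by blast

lemma disjoint_cross: "G \<inter> cross A B = {} \<longleftrightarrow> (\<forall>a\<in>A. \<forall>b\<in>B. {a, b} \<notin> G)"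
  unfolding cross_def by auto

lemma card_subsets_le:
  assumes "k \<le> n"
  shows "card {A. A \<subseteq> {..<n} \<and> card A = k} \<le> n ^ k"
  using n_subsets[of "{..<n}" k] binomial_le_pow[OF assms] by simp

lemma finite_subsets: "finite {A. A \<subseteq> {..<n::nat} \<and> P A}"
  by (rule finite_subset[of _ "Pow {..<n}"]) auto

lemma not_joined_prob:
  assumes p: "0 \<le> p" "p \<le> 1" and "m \<le> n"
  shows "rg_prob n p (\<lambda>G. \<not> joined n G m) \<le> real n ^ (2 * m) * exp (- (p * real (m * m)))"
proof -
  define S where "S = {A. A \<subseteq> {..<n} \<and> card A = m}"
  define I where "I = {(A, B). A \<in> S \<and> B \<in> S \<and> A \<inter> B = {}}"
  have I: "I \<subseteq> S \<times> S" unfolding I_def by auto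
  have "finite S" unfolding S_def by (rule finite_subsets)
  then have finI: "finite I" using I finite_subset by blast
  have "card I \<le> card S * card S"
    using card_mono[OF _ I] \<open>finite S\<close> by (simp add: card_cartesian_product)
  also have "\<dots> \<le> n ^ m * n ^ m"
    using card_subsets_le[OF assms(3)] unfolding S_def by (intro mult_mono) auto
  finally have "card I \<le> n ^ (2 * m)" by (simp add: mult_2 power_add)
  then have cardI: "real (card I) \<le> real n ^ (2 * m)" by (metis of_nat_le_iff of_nat_power)
  have "rg_prob n p (\<lambda>G. \<not> joined n G m) \<le> (\<Sum>i\<in>I. rg_prob n p (\<lambda>G. G \<inter> cross (fst i) (snd i) = {}))"
  proof (rule rg_prob_union_bound[OF p finI])
    fix G assume "\<not> joined n G m"
    then obtain A B where AB: "A \<subseteq> {..<n}" "B \<subseteq> {..<n}" "A \<inter> B = {}" "m \<le> card A" "m \<le> card B"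
      and no: "\<forall>a\<in>A. \<forall>b\<in>B. {a, b} \<notin> G" unfolding joined_def by blast
    obtain A' B' where "A' \<subseteq> A" "card A' = m" "B' \<subseteq> B" "card B' = m"
      using obtain_subset_with_card_n AB by metis
    then have "(A', B') \<in> I" using AB unfolding I_def S_def by auto
    moreover have "G \<inter> cross A' B' = {}"
      unfolding disjoint_cross using no \<open>A' \<subseteq> A\<close> \<open>B' \<subseteq> B\<close> by blast
    ultimately show "\<exists>i\<in>I. G \<inter> cross (fst i) (snd i) = {}" by force
  qed
  also have "\<dots> \<le> (\<Sum>i\<in>I. exp (- (p * real (m * m))))"
  proof (rule sum_mono)
    fix i assume "i \<in> I"
    then obtain A B where i: "i = (A, B)" "A \<in> S" "B \<in> S" "A \<inter> B = {}" unfolding I_def by auto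
    then show "rg_prob n p (\<lambda>G. G \<inter> cross (fst i) (snd i) = {}) \<le> exp (- (p * real (m * m)))"
      using cross_subset[of A n B] by (intro rg_prob_no_edges_le[OF p]) (auto simp: S_def card_cross)
  qed
  also have "\<dots> \<le> real n ^ (2 * m) * exp (- (p * real (m * m)))"
    using cardI by (simp add: mult_right_mono)
  finally show ?thesis .
qed

text \<open>A violating A of size a has its outer neighbours inside some B of exactly d a vertices,
  so it has no edge to the others, at least n/2 of them by the bound on M. Per element of A, the
  factor n^(d+1) pays for choosing A and B.\<close>

lemma not_expanding_prob:
  assumes p: "0 \<le> p" "p \<le> 1" and M: "2 * (d + 1) * M \<le> n"
  shows "rg_prob n p (\<lambda>G. \<not> expanding n G M d)
    \<le> (\<Sum>a\<in>{1..M}. (real n ^ (d + 1) * exp (- (p * real n / 2))) ^ a)"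
proof -
  define Ev where "Ev = (\<lambda>a G. \<exists>A\<subseteq>{..<n}. card A = a \<and> card (neighbours G A - A) < d * a)"
  have "rg_prob n p (\<lambda>G. \<not> expanding n G M d) \<le> (\<Sum>a\<in>{1..M}. rg_prob n p (Ev a))"
  proof (rule rg_prob_union_bound[OF p])
    fix G assume "\<not> expanding n G M d"
    then obtain A where A: "A \<subseteq> {..<n}" "A \<noteq> {}" "card A \<le> M" "card (neighbours G A - A) < d * card A"
      unfolding expanding_def by (auto simp: not_le)
    moreover have "card A \<noteq> 0" using A finite_subset by auto
    ultimately show "\<exists>a\<in>{1..M}. Ev a G" unfolding Ev_def by (intro bexI[of _ "card A"]) auto
  qed simp
  also have "\<dots> \<le> (\<Sum>a\<in>{1..M}. (real n ^ (d + 1) * exp (- (p * real n / 2))) ^ a)"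
  proof (rule sum_mono)
    fix a assume a: "a \<in> {1..M}"
    have "2 * (d + 1) * a \<le> 2 * (d + 1) * M" using a by (intro mult_le_mono2) auto
    then have small: "2 * (d * a + a) \<le> n" using M by (simp add: algebra_simps)
    define S where "S = {A. A \<subseteq> {..<n} \<and> card A = a}"
    define R where "R = {B. B \<subseteq> {..<n} \<and> card B = d * a}"
    have fin: "finite (S \<times> R)" unfolding S_def R_def by (intro finite_cartesian_product finite_subsets)
    have "card (S \<times> R) \<le> n ^ a * n ^ (d * a)"
      using card_subsets_le[of a n] card_subsets_le[of "d * a" n] small
      unfolding S_def R_def card_cartesian_product by (intro mult_mono) auto
    also have "\<dots> = n ^ ((d + 1) * a)" by (simp add: power_add add.commute)
    finally have "card (S \<times> R) \<le> n ^ ((d + 1) * a)" .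
    then have cardI: "real (card (S \<times> R)) \<le> real n ^ ((d + 1) * a)" by (metis of_nat_le_iff of_nat_power)
    have "rg_prob n p (Ev a) \<le> (\<Sum>i\<in>S \<times> R. rg_prob n p (\<lambda>G. G \<inter> cross (fst i) ({..<n} - fst i - snd i) = {}))"
    proof (rule rg_prob_union_bound[OF p fin])
      fix G assume G: "G \<in> graphs n" "Ev a G"
      then obtain A where A: "A \<subseteq> {..<n}" "card A = a" "card (neighbours G A - A) < d * a"
        unfolding Ev_def by auto
      have sub: "neighbours G A - A \<subseteq> {..<n}" using G(1) by (auto simp: neighbours_def dest: graphsD)
      then obtain B where B: "neighbours G A - A \<subseteq> B" "B \<subseteq> {..<n}" "card B = d * a"
        using exists_subset_between[of "neighbours G A - A" "d * a" "{..<n}"] A(3) small by auto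
      have "G \<inter> cross A ({..<n} - A - B) = {}"
        unfolding disjoint_cross using B(1) by (auto simp: neighbours_def)
      then show "\<exists>i\<in>S \<times> R. G \<inter> cross (fst i) ({..<n} - fst i - snd i) = {}"
        using A B by (intro bexI[of _ "(A, B)"]) (auto simp: S_def R_def)
    qed
    also have "\<dots> \<le> (\<Sum>i\<in>S \<times> R. exp (- (p * (real n / 2 * real a))))"
    proof (rule sum_mono)
      fix i assume "i \<in> S \<times> R"
      then obtain A B where i: "i = (A, B)" and A: "A \<subseteq> {..<n}" "card A = a" and B: "B \<subseteq> {..<n}" "card B = d * a"
        unfolding S_def R_def by auto
      have "n - (a + d * a) \<le> card ({..<n} - (A \<union> B))"
        using diff_card_le_card_Diff[of "A \<union> B" "{..<n}"] card_Un_le[of A B] A B finite_subset[of _ "{..<n}"]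
        by (auto simp: finite_subset)
      then have "real n / 2 \<le> real (card ({..<n} - A - B))" using small by (simp add: Diff_eq Int_assoc Compl_Un)
      then have "real n / 2 * real a \<le> real (card (cross A ({..<n} - A - B)))"
        using A(2) mult_right_mono[of "real n / 2" "real (card ({..<n} - A - B))" "real a"]
        by (subst card_cross) (auto simp: mult.commute)
      then show "rg_prob n p (\<lambda>G. G \<inter> cross (fst i) ({..<n} - fst i - snd i) = {}) \<le> exp (- (p * (real n / 2 * real a)))"
        unfolding i using A cross_subset[of A n "{..<n} - A - B"] by (intro rg_prob_no_edges_le[OF p]) auto
    qed
    also have "\<dots> \<le> real n ^ ((d + 1) * a) * exp (- (p * (real n / 2 * real a)))"
      using cardI by (simp add: mult_right_mono)
    also have "\<dots> = (real n ^ (d + 1) * exp (- (p * real n / 2))) ^ a"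
      by (simp add: power_mult_distrib power_mult[symmetric] exp_of_nat_mult[symmetric] power_add mult_ac)
    finally show "rg_prob n p (Ev a) \<le> (real n ^ (d + 1) * exp (- (p * real n / 2))) ^ a" .
  qed
  finally show ?thesis .
qed


text \<open>A forbidden edge can be counted from both of its ends; this bounds the loss by a factor
  of two.\<close>

lemma card_unordered_pairs:
  assumes "finite S"
  shows "card S \<le> 2 * card ((\<lambda>(a, b). {a, b}) ` S)"
proof -
  let ?f = "\<lambda>(a, b). {a, b}"
  have "S \<subseteq> (\<Union>e\<in>?f ` S. {x. ?f x = e})" by auto
  have fib: "finite {x. ?f x = e} \<and> card {x. ?f x = e} \<le> 2" if "e \<in> ?f ` S" for e
  proof -
    obtain a b where e: "e = {a, b}" using \<open>e \<in> ?f ` S\<close> by auto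
    have sub: "{x. ?f x = e} \<subseteq> {(a, b), (b, a)}"
    proof
      fix x assume "x \<in> {x. ?f x = e}"
      then have "{fst x, snd x} = {a, b}" unfolding e by (simp add: split_def)
      then show "x \<in> {(a, b), (b, a)}" by (cases x) (simp add: doubleton_eq_iff)
    qed
    have fin2: "finite {(a, b), (b, a)}" and "card (set [(a, b), (b, a)]) \<le> length [(a, b), (b, a)]"
      by (simp, rule card_length)
    then have "card {x. ?f x = e} \<le> 2" using card_mono[OF fin2 sub] by simp
    then show ?thesis using finite_subset[OF sub fin2] by blast
  qed
  have fin: "finite (\<Union>e\<in>?f ` S. {x. ?f x = e})" using fib assms by blast
  have "card S \<le> card (\<Union>e\<in>?f ` S. {x. ?f x = e})" by (rule card_mono[OF fin]) auto
  also have "\<dots> \<le> (\<Sum>e\<in>?f ` S. card {x. ?f x = e})" by (rule card_UN_le) (use assms in auto)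
  also have "\<dots> \<le> (\<Sum>e\<in>?f ` S. 2)" by (rule sum_mono) (use fib in auto)
  finally show ?thesis by simp
qed

text \<open>The union bound runs over \<open>\<sigma>\<close> and over families of witnesses \<open>(A\<^sub>r, C\<^sub>r)\<close> showing that no \<open>r\<close> is a
  good hub, where \<open>C\<^sub>r\<close> covers the few available neighbours of \<open>A\<^sub>r\<close>. Such a family forbids about
  \<open>m \<Sum>\<^sub>r |A\<^sub>r| / 4\<close> edges of \<open>Y\<close>, and this sum is at least \<open>n\<close>, which beats the number of \<open>\<sigma>\<close>.\<close>
lemma no_good_hub_prob:
  assumes p: "0 \<le> p" "p \<le> 1" and X: "X \<in> graphs n" "expanding n X M m"
    and "18 \<le> m" "8 \<le> n" "M \<le> n"
  defines "x \<equiv> exp (- (p * real m / 4))"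
  assumes nx: "real n * x \<le> 1"
  shows "rg_prob n p (\<lambda>Y. \<exists>\<sigma>. \<sigma> permutes {..<n} \<and> (\<forall>r<n. \<not> good_hub n X Y M \<sigma> r)) \<le> (real n ^ 11 * x) ^ n"
proof -
  define SA where "SA = {A. A \<subseteq> {..<n} \<and> A \<noteq> {} \<and> card A \<le> M}"
  define SC where "SC = {C. C \<subseteq> {..<n} \<and> card C = 8}"
  define W where "W = SA \<times> SC"
  \<comment> \<open>The places where no friend of r may stand: the neighbours of A outside A that C
    does not cover.\<close>
  define H where "H = (\<lambda>AC. neighbours X (fst AC) - fst AC - snd AC)"
  define I where "I = {\<sigma>. \<sigma> permutes {..<n}} \<times> PiE {..<n} (\<lambda>_. W)"
  define D where "D = (\<lambda>i. (\<lambda>(y, r). {y, r}) ` {(y, r). r < n \<and> y \<in> fst i ` H (snd i r) \<and> y \<noteq> r})"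
  have fin: "finite SA" "finite SC" unfolding SA_def SC_def by (rule finite_subsets)+
  then have finW: "finite W" unfolding W_def by auto
  have finI: "finite I" unfolding I_def using finW by (intro finite_cartesian_product finite_permutations finite_PiE) auto
  have x0: "0 \<le> x" unfolding x_def by simp
  have Hn: "H AC \<subseteq> {..<n}" for AC using X(1) by (auto simp: H_def neighbours_def dest: graphsD)
  have step1: "rg_prob n p (\<lambda>Y. \<exists>\<sigma>. \<sigma> permutes {..<n} \<and> (\<forall>r<n. \<not> good_hub n X Y M \<sigma> r))
    \<le> (\<Sum>i\<in>I. rg_prob n p (\<lambda>Y. Y \<inter> D i = {}))"
  proof (rule rg_prob_union_bound[OF p finI])
    fix Y assume Y: "Y \<in> graphs n" and "\<exists>\<sigma>. \<sigma> permutes {..<n} \<and> (\<forall>r<n. \<not> good_hub n X Y M \<sigma> r)"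
    then obtain \<sigma> where \<sigma>: "\<sigma> permutes {..<n}" "\<And>r. r < n \<Longrightarrow> \<not> good_hub n X Y M \<sigma> r" by blast
    have "\<exists>AC\<in>W. \<forall>h\<in>H AC. {\<sigma> h, r} \<notin> Y" if r: "r < n" for r
    proof -
      obtain A where A: "A \<subseteq> {..<n}" "A \<noteq> {}" "card A \<le> M"
        "card (neighbours X A \<inter> {h. {\<sigma> h, r} \<in> Y} - A) < 8" (is "card ?N < 8")
        using \<sigma>(2)[OF r] unfolding good_hub_def by (auto simp: not_le)
      have "?N \<subseteq> {..<n}" using X(1) by (auto simp: neighbours_def dest: graphsD)
      then obtain C where "?N \<subseteq> C" "C \<subseteq> {..<n}" "card C = 8"
        using exists_subset_between[of ?N 8 "{..<n}"] A(4) \<open>8 \<le> n\<close> by auto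
      then show ?thesis using A unfolding W_def SA_def SC_def H_def by (intro bexI[of _ "(A, C)"]) auto
    qed
    then obtain f where f: "\<And>r. r < n \<Longrightarrow> f r \<in> W \<and> (\<forall>h\<in>H (f r). {\<sigma> h, r} \<notin> Y)" by metis
    let ?f = "restrict f {..<n}"
    have "(\<sigma>, ?f) \<in> I" unfolding I_def using \<sigma>(1) f by auto
    moreover have "Y \<inter> D (\<sigma>, ?f) = {}" unfolding D_def using f by auto
    ultimately show "\<exists>i\<in>I. Y \<inter> D i = {}" by blast
  qed
  have step2: "rg_prob n p (\<lambda>Y. Y \<inter> D i = {}) \<le> (\<Prod>r<n. x ^ card (fst (snd i r)))" if iI: "i \<in> I" for i
  proof -
    obtain \<sigma> f where i: "i = (\<sigma>, f)" and \<sigma>: "\<sigma> permutes {..<n}" and f: "\<And>r. r < n \<Longrightarrow> f r \<in> W"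
    proof -
      have "fst i permutes {..<n}" "snd i \<in> PiE {..<n} (\<lambda>_. W)" using iI unfolding I_def mem_Times_iff by simp_all
      then have "fst i permutes {..<n}" "\<And>r. r < n \<Longrightarrow> snd i r \<in> W" using PiE_mem by fastforce+
      then show ?thesis using that[of "fst i" "snd i"] by simp
    qed
    let ?S = "{(y, r). r < n \<and> y \<in> \<sigma> ` H (f r) \<and> y \<noteq> r}"
    have yn: "y < n" if "y \<in> \<sigma> ` H AC" for y AC
      using that Hn[of AC] permutes_in_image[OF \<sigma>] by auto
    have Sdec: "?S = (\<lambda>(r, y). (y, r)) ` (SIGMA r:{..<n}. \<sigma> ` H (f r) - {r})" by force
    have finH: "finite (\<sigma> ` H AC)" for AC using Hn finite_subset by blast
    have finS: "finite ?S" unfolding Sdec using finH by (intro finite_imageI finite_SigmaI) auto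
    have "card ?S = card (SIGMA r:{..<n}. \<sigma> ` H (f r) - {r})"
      unfolding Sdec by (rule card_image) (auto simp: inj_on_def)
    also have "\<dots> = (\<Sum>r<n. card (\<sigma> ` H (f r) - {r}))" using finH by (subst card_SigmaI) auto
    finally have cS: "card ?S = (\<Sum>r<n. card (\<sigma> ` H (f r) - {r}))" .
    have each: "real m / 2 * real (card (fst (f r))) \<le> real (card (\<sigma> ` H (f r) - {r}))" if r: "r < n" for r
    proof -
      obtain A C where AC: "f r = (A, C)" "A \<subseteq> {..<n}" "A \<noteq> {}" "card A \<le> M" "C \<subseteq> {..<n}" "card C = 8"
        using f[OF r] unfolding W_def SA_def SC_def by auto
      have "m * card A \<le> card (neighbours X A - A)" using X(2) AC unfolding expanding_def by blast
      also have "\<dots> - 8 \<le> card (neighbours X A - A - C)"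
        using diff_card_le_card_Diff[of C "neighbours X A - A"] AC finite_subset by (metis finite_lessThan)
      finally have "m * card A - 8 \<le> card (H (f r))" unfolding H_def AC by simp
      moreover have "card (\<sigma> ` H (f r)) = card (H (f r))"
        using permutes_inj[OF \<sigma>] by (intro card_image) (auto intro: inj_on_subset)
      moreover have "card (\<sigma> ` H (f r)) - 1 \<le> card (\<sigma> ` H (f r) - {r})"
        by (simp add: card_Diff_singleton_if)
      \<comment> \<open>Lost are 8 places to C and possibly r itself, as no edge joins r to r. Since
        m |A| is at least 18, half of it remains.\<close>
      ultimately have le: "m * card A \<le> card (\<sigma> ` H (f r) - {r}) + 9" by linarith
      have "card A \<noteq> 0" using AC(3) finite_subset[OF AC(2)] by simp
      then have "18 * 1 \<le> m * card A" using \<open>18 \<le> m\<close> by (intro mult_le_mono) auto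
      then have "m * card A \<le> 2 * card (\<sigma> ` H (f r) - {r})" using le by linarith
      then have "real (m * card A) \<le> real (2 * card (\<sigma> ` H (f r) - {r}))" by (simp only: of_nat_le_iff)
      then show ?thesis by (simp add: AC)
    qed
    \<comment> \<open>The second halving, from m/2 to m/4, passes from ordered to unordered
      pairs.\<close>
    have "real m / 4 * (\<Sum>r<n. real (card (fst (f r)))) = (\<Sum>r<n. real m / 2 * real (card (fst (f r)))) / 2"
      by (subst sum_distrib_left[symmetric]) simp
    also have "\<dots> \<le> (\<Sum>r<n. real (card (\<sigma> ` H (f r) - {r}))) / 2"
      using each by (intro divide_right_mono sum_mono) auto
    also have "\<dots> = real (card ?S) / 2" unfolding cS by simp
    also have "\<dots> \<le> real (card (D i))"
      using card_unordered_pairs[OF finS] unfolding D_def i by simp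
    finally have c: "real m / 4 * (\<Sum>r<n. real (card (fst (f r)))) \<le> real (card (D i))" .
    have "D i \<subseteq> all_edges n"
    proof
      fix e assume "e \<in> D i"
      then obtain y r where "e = {y, r}" "r < n" "y \<in> \<sigma> ` H (f r)" "y \<noteq> r" unfolding D_def i by auto
      moreover from this have "y < n" using yn by blast
      ultimately show "e \<in> all_edges n" unfolding all_edges_def by blast
    qed
    then have "rg_prob n p (\<lambda>Y. Y \<inter> D i = {}) \<le> exp (- (p * (real m / 4 * (\<Sum>r<n. real (card (fst (f r)))))))"
      using c by (rule rg_prob_no_edges_le[OF p])
    also have "- (p * (real m / 4 * (\<Sum>r<n. real (card (fst (f r)))))) = (\<Sum>r<n. real (card (fst (f r))) * (- (p * real m / 4)))"
      by (subst sum_distrib_right[symmetric]) simp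
    also have "exp \<dots> = (\<Prod>r<n. x ^ card (fst (f r)))"
      unfolding x_def by (simp only: exp_sum[OF finite_lessThan] exp_of_nat_mult)
    finally show ?thesis unfolding i by simp
  qed
  \<comment> \<open>At most n^a sets have size a, so together they weigh at most (n x)^a <= n x, and
    at most M <= n sizes occur.\<close>
  have "(\<Sum>A\<in>SA. x ^ card A) \<le> real n * (real n * x)"
  proof -
    let ?B = "\<lambda>a. {A. A \<subseteq> {..<n} \<and> card A = a}"
    have finB: "finite (?B a)" for a by (rule finite_subsets)
    have "SA \<subseteq> (\<Union>a\<in>{1..M}. ?B a)"
    proof
      fix A assume "A \<in> SA"
      then have A: "A \<subseteq> {..<n}" "A \<noteq> {}" "card A \<le> M" unfolding SA_def by auto
      then have "card A \<noteq> 0" using finite_subset[OF A(1)] by simp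
      then show "A \<in> (\<Union>a\<in>{1..M}. ?B a)" using A by auto
    qed
    then have "(\<Sum>A\<in>SA. x ^ card A) \<le> (\<Sum>A\<in>(\<Union>a\<in>{1..M}. ?B a). x ^ card A)"
      using x0 finB by (intro sum_mono2) auto
    also have "\<dots> = (\<Sum>a\<in>{1..M}. \<Sum>A\<in>?B a. x ^ card A)"
      using finB by (intro sum.UNION_disjoint) auto
    also have "\<dots> \<le> (\<Sum>a\<in>{1..M}. real n * x)"
    proof (rule sum_mono)
      fix a assume a: "a \<in> {1..M}"
      have "(\<Sum>A\<in>?B a. x ^ card A) = real (card (?B a)) * x ^ a" by simp
      also have "card (?B a) \<le> n ^ a" using card_subsets_le[of a n] a \<open>M \<le> n\<close> by simp
      then have "real (card (?B a)) * x ^ a \<le> real n ^ a * x ^ a"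
        using x0 by (intro mult_right_mono) (metis of_nat_le_iff of_nat_power, simp)
      also have "\<dots> = (real n * x) ^ a" by (simp add: power_mult_distrib)
      also have "\<dots> \<le> (real n * x) ^ 1" using a nx x0 by (intro power_decreasing) auto
      finally show "(\<Sum>A\<in>?B a. x ^ card A) \<le> real n * x" by simp
    qed
    also have "\<dots> = real M * (real n * x)" by simp
    also have "\<dots> \<le> real n * (real n * x)" using \<open>M \<le> n\<close> x0 by (intro mult_right_mono) auto
    finally show ?thesis .
  qed
  moreover have "real (card SC) \<le> real n ^ 8"
    using card_subsets_le[OF \<open>8 \<le> n\<close>] unfolding SC_def by (metis of_nat_le_iff of_nat_power)
  ultimately have "(\<Sum>A\<in>SA. x ^ card A) * real (card SC) \<le> real n * (real n * x) * real n ^ 8"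
    using x0 by (intro mult_mono) auto
  moreover have "(\<Sum>w\<in>W. x ^ card (fst w)) = (\<Sum>A\<in>SA. x ^ card A) * real (card SC)"
  proof -
    have "(\<Sum>w\<in>W. x ^ card (fst w)) = (\<Sum>A\<in>SA. \<Sum>C\<in>SC. x ^ card A)"
      unfolding W_def sum.cartesian_product split_def ..
    then show ?thesis by (simp add: sum_distrib_left mult.commute)
  qed
  moreover have "real n * (real n * x) * real n ^ 8 = real n ^ 10 * x" by (simp add: eval_nat_numeral)
  ultimately have sumW: "(\<Sum>w\<in>W. x ^ card (fst w)) \<le> real n ^ 10 * x"
    by simp
  \<comment> \<open>The weights multiply over r, so the sum over all families of witnesses is an
    n-th power; the choice of \<sigma> costs n! <= n^n, which turns n^10 into n^11.\<close>
  have "(\<Sum>i\<in>I. rg_prob n p (\<lambda>Y. Y \<inter> D i = {})) \<le> (\<Sum>i\<in>I. \<Prod>r<n. x ^ card (fst (snd i r)))"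
    using step2 by (rule sum_mono)
  also have "\<dots> = (\<Sum>\<sigma> | \<sigma> permutes {..<n}. \<Sum>f\<in>PiE {..<n} (\<lambda>_. W). \<Prod>r<n. x ^ card (fst (f r)))"
    unfolding I_def sum.cartesian_product split_def ..
  also have "\<dots> = fact n * (\<Sum>f\<in>PiE {..<n} (\<lambda>_. W). \<Prod>r<n. x ^ card (fst (f r)))"
    using card_permutations[of "{..<n}" n] by simp
  also have "(\<Sum>f\<in>PiE {..<n} (\<lambda>_. W). \<Prod>r<n. x ^ card (fst (f r))) = (\<Prod>r<n. \<Sum>w\<in>W. x ^ card (fst w))"
    using finW by (intro prod_sum_PiE[symmetric]) auto
  also have "\<dots> = (\<Sum>w\<in>W. x ^ card (fst w)) ^ n" by simp
  also have "fact n * \<dots> \<le> real n ^ n * (real n ^ 10 * x) ^ n"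
    using fact_le_power[of n, where 'a = real] sumW x0 by (intro mult_mono power_mono sum_nonneg zero_le_power) auto
  also have "\<dots> = (real n ^ 11 * x) ^ n"
  proof -
    have "real n ^ 11 * x = real n * (real n ^ 10 * x)" by (simp add: eval_nat_numeral)
    then show ?thesis by (simp only: power_mult_distrib)
  qed
  finally show ?thesis using step1 by linarith
qed

section \<open>Choice of m and assembly of the bounds\<close>

text \<open>The 48 gives exp (- p m / 4) <= n^(-12), one power below the n^11 of
  \<open>no_good_hub_prob\<close>; the 25 makes room for the expansion of sets of size 4 m + 10 by
  the factor m. The error 5/n is 2/n for each graph and 1/n for the hubs.\<close>

lemma FS_disconnected_prob_le:
  assumes p1: "0 \<le> p1" "p1 \<le> 1" and p2: "0 \<le> p2" "p2 \<le> 1"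
    and m: "18 \<le> m" "25 * m * m \<le> n"
    and pm: "48 * ln (real n) \<le> p1 * real m" "48 * ln (real n) \<le> p2 * real m"
  shows "pair_prob n p1 p2 (\<lambda>X Y. \<not> FS_connected n X Y) \<le> 5 / real n"
proof -
  define L where "L = ln (real n)"
  have "18 * 18 \<le> m * m" using m by (intro mult_le_mono) auto
  then have n: "100 \<le> n" using m by simp
  have n0: "real n > 0" using n by simp
  have L: "0 < L" unfolding L_def using n by simp
  have expL: "real n ^ k = exp (real k * L)" for k
    using n0 by (simp add: L_def exp_of_nat_mult)
  have inv: "exp (- L) = 1 / real n" using n0 by (simp add: L_def exp_minus inverse_eq_divide)
  have "18 * m \<le> m * m" using m by (intro mult_le_mono1) simp
  moreover have "25 * (m * m) \<le> n" using m(2) by (simp add: mult.assoc)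
  moreover have "2 * (m + 1) * (4 * m + 10) = 8 * (m * m) + 28 * m + 20" by (simp add: algebra_simps)
  ultimately have mn: "2 * (m + 1) * (4 * m + 10) \<le> n" and Mn: "4 * m + 10 \<le> n"
    using m(1) by linarith+
  let ?M = "4 * m + 10"
  have joined: "rg_prob n p (\<lambda>G. \<not> joined n G m) \<le> 1 / real n"
    if p: "0 \<le> p" "p \<le> 1" and pm: "48 * L \<le> p * real m" for p
  proof -
    have "rg_prob n p (\<lambda>G. \<not> joined n G m) \<le> real n ^ (2 * m) * exp (- (p * real (m * m)))"
      using mn by (intro not_joined_prob[OF p]) simp
    also have "\<dots> = exp (2 * real m * L - p * real m * real m)"
      unfolding expL by (simp add: exp_add[symmetric])
    also have "\<dots> \<le> exp (- L)"
    proof -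
      define a b where "a = L * real m" and "b = p * real m * real m"
      have "48 * L * real m \<le> p * real m * real m" using pm by (intro mult_right_mono) auto
      then have "48 * a \<le> b" by (simp add: a_def b_def)
      moreover have "L * 1 \<le> a" unfolding a_def using L m by (intro mult_left_mono) auto
      ultimately have "2 * a - b \<le> - L" using L by linarith
      then show ?thesis by (simp add: a_def b_def mult_ac)
    qed
    finally show ?thesis using inv by simp
  qed
  have expanding: "rg_prob n p (\<lambda>G. \<not> expanding n G ?M m) \<le> 1 / real n"
    if p: "0 \<le> p" "p \<le> 1" and pm: "48 * L \<le> p * real m" for p
  proof -
    let ?y = "real n ^ (m + 1) * exp (- (p * real n / 2))"
    have "?y = exp ((real m + 1) * L - p * real n / 2)"
      unfolding expL by (simp add: exp_add[symmetric])
    \<comment> \<open>The square is wanted because the sum over at most n sizes costs a factor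
      n.\<close>
    also have "\<dots> \<le> exp (real 2 * - L)"
    proof -
      define a b where "a = L * real m" and "b = p * real m * real m"
      have "p * real (25 * m * m) \<le> p * real n" using p m by (intro mult_left_mono) (simp_all only: of_nat_le_iff)
      then have "25 * b \<le> p * real n" by (simp add: b_def mult_ac)
      moreover have "48 * L * real m \<le> p * real m * real m" using pm by (intro mult_right_mono) auto
      then have "48 * a \<le> b" by (simp add: a_def b_def)
      moreover have "L * 1 \<le> a" unfolding a_def using L m by (intro mult_left_mono) auto
      ultimately have "a + L - p * real n / 2 \<le> - (2 * L)" using L by linarith
      then show ?thesis by (simp add: a_def algebra_simps)
    qed
    also have "\<dots> = (1 / real n) ^ 2" unfolding exp_of_nat_mult inv by simp
    finally have y: "?y \<le> (1 / real n) ^ 2" .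
    have y0: "0 \<le> ?y" by simp
    have "?y \<le> 1" using y n power_le_one[of "1 / real n" 2] by simp
    have "rg_prob n p (\<lambda>G. \<not> expanding n G ?M m) \<le> (\<Sum>a\<in>{1..?M}. ?y ^ a)"
      by (rule not_expanding_prob[OF p mn])
    also have "\<dots> \<le> (\<Sum>a\<in>{1..?M}. ?y ^ 1)"
      using y0 \<open>?y \<le> 1\<close> by (intro sum_mono power_decreasing) auto
    also have "\<dots> = real ?M * ?y" by simp
    also have "\<dots> \<le> real n * (1 / real n) ^ 2" using y y0 Mn by (intro mult_mono) (simp_all only: of_nat_le_iff of_nat_0_le_iff)
    also have "\<dots> = 1 / real n" using n0 by (simp add: power2_eq_square)
    finally show ?thesis .
  qed
  have bad: "rg_prob n p (\<lambda>G. \<not> joined n G m \<or> \<not> expanding n G ?M m) \<le> 2 / real n"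
    if p: "0 \<le> p" "p \<le> 1" "48 * L \<le> p * real m" for p
    using rg_prob_disj[OF p(1,2), of n "\<lambda>G. \<not> joined n G m" "\<lambda>G. \<not> expanding n G ?M m"] joined[OF p] expanding[OF p]
    by (simp add: add_divide_distrib)
  have "pair_prob n p1 p2 (\<lambda>X Y. \<not> FS_connected n X Y)
    \<le> rg_prob n p1 (\<lambda>G. \<not> joined n G m \<or> \<not> expanding n G ?M m)
      + rg_prob n p2 (\<lambda>G. \<not> joined n G m \<or> \<not> expanding n G ?M m) + 1 / real n"
  proof (rule pair_prob_le[OF p1 p2, where C = "\<lambda>X Y. \<exists>\<sigma>. \<sigma> permutes {..<n} \<and> (\<forall>r<n. \<not> good_hub n X Y ?M \<sigma> r)"])
    fix X Y assume XY: "X \<in> graphs n" "Y \<in> graphs n" and dis: "\<not> FS_connected n X Y"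
    interpret friends_strangers n X Y by unfold_locales (use XY in auto)
    show "(\<not> joined n X m \<or> \<not> expanding n X ?M m) \<or> (\<not> joined n Y m \<or> \<not> expanding n Y ?M m)
      \<or> (\<exists>\<sigma>. \<sigma> permutes {..<n} \<and> (\<forall>r<n. \<not> good_hub n X Y ?M \<sigma> r))"
      using FS_connected_if_good_hubs[of m] dis m(1) by fastforce
  next
    fix X assume X: "X \<in> graphs n" "\<not> (\<not> joined n X m \<or> \<not> expanding n X ?M m)"
    define x where "x = exp (- (p2 * real m / 4))"
    have "x \<le> exp (real 12 * - L)" unfolding x_def using pm(2) L by (simp add: L_def)
    also have "\<dots> = (1 / real n) ^ 12" unfolding exp_of_nat_mult inv ..
    finally have x: "x \<le> (1 / real n) ^ 12" .
    have "real n * x \<le> real n ^ 11 * x" unfolding x_def using n by (intro mult_right_mono) (auto intro: self_le_power)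
    also have x11: "\<dots> \<le> real n ^ 11 * (1 / real n) ^ 12" using x by (intro mult_left_mono) auto
    also have e: "real n ^ 11 * (1 / real n) ^ 12 = 1 / real n"
      using n0 by (simp add: power_divide field_simps eval_nat_numeral)
    finally have nx: "real n * x \<le> 1 / real n" .
    then have "real n * x \<le> 1" using n by (auto elim: order_trans)
    then have "rg_prob n p2 (\<lambda>Y. \<exists>\<sigma>. \<sigma> permutes {..<n} \<and> (\<forall>r<n. \<not> good_hub n X Y ?M \<sigma> r)) \<le> (real n ^ 11 * x) ^ n"
      unfolding x_def using X m n Mn by (intro no_good_hub_prob[OF p2 X(1)]) auto
    also have "\<dots> \<le> (real n ^ 11 * x) ^ 1"
      using x11 e n by (intro power_decreasing) (auto simp: x_def elim: order_trans)
    also have "\<dots> \<le> 1 / real n" using x11 e by simp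
    finally show "rg_prob n p2 (\<lambda>Y. \<exists>\<sigma>. \<sigma> permutes {..<n} \<and> (\<forall>r<n. \<not> good_hub n X Y ?M \<sigma> r)) \<le> 1 / real n" .
  qed (use n0 in auto)
  also have "\<dots> \<le> 2 / real n + 2 / real n + 1 / real n"
    using bad[OF p1] bad[OF p2] pm unfolding L_def by (intro add_mono) auto
  finally show ?thesis by (simp add: add_divide_distrib[symmetric])
qed

theorem FS_connected_whp:
  assumes p: "\<And>n. 0 \<le> p1 n \<and> p1 n \<le> 1" "\<And>n. 0 \<le> p2 n \<and> p2 n \<le> 1"
    and ev: "eventually (\<lambda>n. p1 n \<ge> 300 * ln (real n) / sqrt (real n) \<and> p2 n \<ge> 300 * ln (real n) / sqrt (real n)) sequentially"
  shows "whp (\<lambda>n. pair_prob n (p1 n) (p2 n) (FS_connected n))"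
proof (rule whp_pair_probI[OF p])
  show "(\<lambda>n. 5 / real n) \<longlonglongrightarrow> 0" by real_asymp
  have "eventually (\<lambda>n. 40000 \<le> n) sequentially" by (rule eventually_ge_at_top)
  then show "eventually (\<lambda>n. pair_prob n (p1 n) (p2 n) (\<lambda>X Y. \<not> FS_connected n X Y) \<le> 5 / real n) sequentially"
    using ev
  proof eventually_elim
    case (elim n)
    \<comment> \<open>The largest m with 25 m^2 <= n. From sqrt n >= 200 on it is at least sqrt n /
      6, so 300 yields p m >= 50 log n.\<close>
    define m where "m = nat \<lfloor>sqrt (real n) / 5\<rfloor>"
    have "sqrt (200\<^sup>2) \<le> sqrt (real n)" using elim by (intro real_sqrt_le_mono) auto
    then have s: "200 \<le> sqrt (real n)" by simp
    have m: "real m \<le> sqrt (real n) / 5" "sqrt (real n) / 5 < real m + 1"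
      unfolding m_def using s by linarith+
    have m6: "sqrt (real n) / 6 \<le> real m" using m(2) s by linarith
    have "real m * real m \<le> (sqrt (real n) / 5) * (sqrt (real n) / 5)" using m by (intro mult_mono) auto
    then have "real (25 * m * m) \<le> real n" by simp
    then have mm: "25 * m * m \<le> n" by (simp only: of_nat_le_iff)
    have "18 \<le> m" using m6 s by linarith
    have L: "0 \<le> ln (real n)" using elim by simp
    have pm: "48 * ln (real n) \<le> q * real m" if "q \<ge> 300 * ln (real n) / sqrt (real n)" for q
    proof -
      have "0 \<le> q" using that L s by (meson divide_nonneg_pos mult_nonneg_nonneg order_trans less_le_trans zero_le_numeral zero_less_numeral)
      then have "300 * ln (real n) / sqrt (real n) * (sqrt (real n) / 6) \<le> q * real m"
        using that m6 L s by (intro mult_mono) auto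
      moreover have "300 * ln (real n) / sqrt (real n) * (sqrt (real n) / 6) = 50 * ln (real n)" using s by simp
      ultimately show ?thesis using L by linarith
    qed
    show ?case
      using p elim pm \<open>18 \<le> m\<close> mm by (intro FS_disconnected_prob_le[of _ _ m]) auto
  qed
qed

text \<open>The factor exp (2 (log n)^(2/3)) outgrows every power of log n, here 150 (log
  n)^(4/3).\<close>

lemma p0_lower_bound:
  "eventually (\<lambda>n. 300 * ln (real n) / sqrt (real n) \<le> 2 / (ln (real n) powr (1/3)) * p0 n) sequentially"
proof -
  have "eventually (\<lambda>n. 300 * ln (real n) \<le> 2 / (ln (real n) powr (1/3)) * exp (2 * ln (real n) powr (2/3))) sequentially"
    by real_asymp
  then show ?thesis
  proof eventually_elim
    case (elim n)
    then have "300 * ln (real n) / sqrt (real n) \<le> 2 / (ln (real n) powr (1/3)) * exp (2 * ln (real n) powr (2/3)) / sqrt (real n)"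
      by (intro divide_right_mono) auto
    then show ?case by (simp add: p0_def)
  qed
qed

section \<open>Disconnectedness\<close>

lemma FS_not_connectedI:
  assumes "\<sigma> \<in> FS_vertices n" "\<tau> \<in> FS_vertices n" "I \<sigma>" "\<not> I \<tau>"
    and inv: "\<And>u v. I u \<Longrightarrow> FS_adj X Y u v \<Longrightarrow> I v"
  shows "\<not> FS_connected n X Y"
proof
  assume "FS_connected n X Y"
  then have "(\<sigma>, \<tau>) \<in> {(u, v). u \<in> FS_vertices n \<and> v \<in> FS_vertices n \<and> FS_adj X Y u v}\<^sup>*"
    using assms(1,2) unfolding FS_connected_def by blast
  then have "I \<tau>" by (induction rule: rtrancl_induct) (use assms(3) inv in auto)
  then show False using assms(4) by blast
qed

lemma exists_moving_permutation:
  assumes "2 \<le> n" "v < n"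
  shows "\<exists>\<tau>. \<tau> \<in> FS_vertices n \<and> \<tau> v \<noteq> v"
proof -
  define w where "w = (if v = 0 then 1 else 0 :: nat)"
  have "w < n" "w \<noteq> v" using assms by (auto simp: w_def)
  then have "transpose v w \<in> FS_vertices n" using assms by (simp add: FS_vertices_def permutes_swap_id)
  then show ?thesis using \<open>w \<noteq> v\<close> by (intro exI[of _ "transpose v w"]) simp
qed

text \<open>The invariant \<sigma> v = v serves both cases: isolation in X freezes the place v,
  isolation in Y freezes the person v.\<close>

lemma isolated_disconnected:
  assumes "2 \<le> n" "v < n" and iso: "(\<forall>w. {v, w} \<notin> X) \<or> (\<forall>w. {v, w} \<notin> Y)"
  shows "\<not> FS_connected n X Y"
proof -
  obtain \<tau> where \<tau>: "\<tau> \<in> FS_vertices n" "\<tau> v \<noteq> v" using exists_moving_permutation[OF assms(1,2)] by auto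
  have id: "id \<in> FS_vertices n" by (simp add: FS_vertices_def permutes_id)
  show ?thesis
  proof (rule FS_not_connectedI[OF id \<tau>(1), where I = "\<lambda>\<sigma>. \<sigma> v = v"])
    fix \<sigma> \<sigma>' assume "\<sigma> v = v" "FS_adj X Y \<sigma> \<sigma>'"
    then obtain a b where ab: "{a, b} \<in> X" "{\<sigma> a, \<sigma> b} \<in> Y" "\<forall>c. c \<noteq> a \<and> c \<noteq> b \<longrightarrow> \<sigma>' c = \<sigma> c"
      unfolding FS_adj_def by auto
    have "v \<noteq> a" "v \<noteq> b" using iso ab(1,2) \<open>\<sigma> v = v\<close> by (auto simp: insert_commute)
    then show "\<sigma>' v = v" using ab(3) \<open>\<sigma> v = v\<close> by auto
  qed (use \<tau> in auto)
qed

text \<open>Sauer--Spencer: a \<open>\<sigma>\<close> with the least number of common edges has none, because the image of an endpoint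
  \<open>b\<close> of a common edge can be exchanged with that of some \<open>c\<close> so that no new common edge arises.\<close>
lemma edge_disjoint_placement:
  assumes X: "X \<in> graphs n" and Y: "Y \<in> graphs n"
    and dX: "\<And>v. v < n \<Longrightarrow> card (neighbours X {v}) \<le> d"
    and dY: "\<And>v. v < n \<Longrightarrow> card (neighbours Y {v}) \<le> e"
    and small: "2 * d * e + 1 < n"
  shows "\<exists>\<sigma>. \<sigma> permutes {..<n} \<and> (\<forall>x y. {x, y} \<in> X \<longrightarrow> {\<sigma> x, \<sigma> y} \<notin> Y)"
proof -
  define Cf where "Cf = (\<lambda>\<sigma>::nat \<Rightarrow> nat. {f \<in> X. \<sigma> ` f \<in> Y})"
  have "finite X" using X finite_all_edges finite_subset unfolding graphs_def by auto
  then have finC: "finite (Cf \<sigma>)" for \<sigma> unfolding Cf_def by auto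
  obtain \<sigma> where \<sigma>: "\<sigma> permutes {..<n}" and min: "\<And>\<tau>. \<tau> permutes {..<n} \<Longrightarrow> card (Cf \<sigma>) \<le> card (Cf \<tau>)"
    using ex_has_least_nat[of "\<lambda>\<sigma>. \<sigma> permutes {..<n}" id "\<lambda>\<sigma>. card (Cf \<sigma>)"] permutes_id by blast
  have "{\<sigma> a, \<sigma> b} \<notin> Y" if ab: "{a, b} \<in> X" for a b
  proof
    assume conf: "{\<sigma> a, \<sigma> b} \<in> Y"
    have abn: "a < n" "b < n" "a \<noteq> b" using graphsD[OF X ab] by auto
    have inj: "inj \<sigma>" using \<sigma> permutes_inj by auto
    have \<sigma>n: "\<sigma> z < n \<longleftrightarrow> z < n" for z using permutes_in_image[OF \<sigma>, of z] by simp
    define NX where "NX = (\<lambda>v. neighbours X {v})"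
    define NY where "NY = (\<lambda>v. neighbours Y {v})"
    have NX: "w \<in> NX v \<longleftrightarrow> {v, w} \<in> X" and NY: "w \<in> NY v \<longleftrightarrow> {v, w} \<in> Y" for v w
      by (auto simp: NX_def NY_def neighbours_def)
    have subX: "NX v \<subseteq> {..<n}" and subY: "NY v \<subseteq> {..<n}" for v
      using graphsD[OF X] graphsD[OF Y] by (auto simp: NX NY)
    have finX: "finite (NX v)" and finY: "finite (NY v)" for v
      by (rule finite_subset[OF subX finite_lessThan], rule finite_subset[OF subY finite_lessThan])
    have cX: "card (NX v) \<le> d" and cY: "card (NY v) \<le> e" if "v < n" for v
      using dX dY that by (auto simp: NX_def NY_def)
    \<comment> \<open>The bad choices of c: for c in B1 the person \<sigma> c would make a common
      edge at b, for c in B2 the person \<sigma> b would make one at c. Each set has at most d e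
      elements; excluding a as well accounts for the \<open>+ 1\<close> in
      \<open>small\<close>.\<close>
    define B1 where "B1 = (\<Union>z\<in>NX b. inv \<sigma> ` NY (\<sigma> z))"
    define B2 where "B2 = (\<Union>z\<in>inv \<sigma> ` NY (\<sigma> b). NX z)"
    have "card B1 \<le> (\<Sum>z\<in>NX b. card (inv \<sigma> ` NY (\<sigma> z)))"
      unfolding B1_def by (rule card_UN_le[OF finX])
    also have "\<dots> \<le> (\<Sum>z\<in>NX b. e)"
      using subX cY \<sigma>n by (intro sum_mono order_trans[OF card_image_le[OF finY]]) blast
    also have "\<dots> \<le> d * e" using cX[OF abn(2)] by simp
    finally have c1: "card B1 \<le> d * e" .
    have "card B2 \<le> (\<Sum>z\<in>inv \<sigma> ` NY (\<sigma> b). card (NX z))"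
      unfolding B2_def by (intro card_UN_le finite_imageI finY)
    also have "\<dots> \<le> (\<Sum>z\<in>inv \<sigma> ` NY (\<sigma> b). d)"
    proof (rule sum_mono)
      fix z assume "z \<in> inv \<sigma> ` NY (\<sigma> b)"
      then obtain x where "x \<in> NY (\<sigma> b)" "z = inv \<sigma> x" by blast
      then have "\<sigma> z < n" using subY[of "\<sigma> b"] permutes_inverses(1)[OF \<sigma>] by auto
      then show "card (NX z) \<le> d" using cX \<sigma>n by blast
    qed
    also have "\<dots> \<le> e * d"
      using order_trans[OF card_image_le[OF finY, of "inv \<sigma>" "\<sigma> b"] cY[of "\<sigma> b"]] \<sigma>n abn(2) by simp
    finally have c2: "card B2 \<le> e * d" .
    have "card (insert a (B1 \<union> B2)) \<le> Suc (card (B1 \<union> B2))" by (rule card_insert_le_m1) auto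
    also have "\<dots> \<le> Suc (d * e + e * d)" using card_Un_le[of B1 B2] c1 c2 by linarith
    also have "\<dots> < n" using small by (simp add: mult.assoc mult.commute[of e d])
    finally have "\<not> {..<n} \<subseteq> insert a (B1 \<union> B2)"
      using card_mono[of "insert a (B1 \<union> B2)" "{..<n}"] finX finY by (auto simp: B1_def B2_def)
    then obtain c where c: "c < n" "c \<noteq> a" "c \<notin> B1" "c \<notin> B2" by auto
    have no1: "{\<sigma> c, \<sigma> z} \<notin> Y" if "{b, z} \<in> X" for z
    proof
      assume "{\<sigma> c, \<sigma> z} \<in> Y"
      then have "\<sigma> c \<in> NY (\<sigma> z)" by (simp add: NY insert_commute)
      then have "c \<in> inv \<sigma> ` NY (\<sigma> z)" using permutes_inverses(2)[OF \<sigma>] by (metis imageI)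
      then show False using c(3) that unfolding B1_def NX[symmetric] by blast
    qed
    have no2: "{\<sigma> b, \<sigma> z} \<notin> Y" if "{c, z} \<in> X" for z
    proof
      assume "{\<sigma> b, \<sigma> z} \<in> Y"
      then have "\<sigma> z \<in> NY (\<sigma> b)" by (simp add: NY)
      then have "z \<in> inv \<sigma> ` NY (\<sigma> b)" using permutes_inverses(2)[OF \<sigma>] by (metis imageI)
      moreover have "c \<in> NX z" using that by (simp add: NX insert_commute)
      ultimately show False using c(4) unfolding B2_def by blast
    qed
    \<comment> \<open>The common edge {a, b} puts b itself into B1.\<close>
    have "c \<noteq> b" using no1[of a] ab conf by (auto simp: insert_commute)
    define \<tau> where "\<tau> = \<sigma> \<circ> transpose b c"
    have \<tau>: "\<tau> permutes {..<n}"
      unfolding \<tau>_def using \<sigma> abn c by (intro permutes_compose permutes_swap_id) auto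
    have \<tau>v: "\<tau> b = \<sigma> c" "\<tau> c = \<sigma> b" "\<And>z. z \<noteq> b \<Longrightarrow> z \<noteq> c \<Longrightarrow> \<tau> z = \<sigma> z"
      by (auto simp: \<tau>_def)
    \<comment> \<open>Edges avoiding b and c keep their images, and so does {b, c}. All other edges
      at b or c are kept out of Y by \<open>no1\<close> and \<open>no2\<close>; as c differs from a,
      the edge {a, b} is among these.\<close>
    have "Cf \<tau> \<subseteq> Cf \<sigma> - {{a, b}}"
    proof
      fix f assume "f \<in> Cf \<tau>"
      then have f: "f \<in> X" "\<tau> ` f \<in> Y" by (auto simp: Cf_def)
      obtain x y where xy: "f = {x, y}" using f(1) X unfolding graphs_def all_edges_def by auto
      have nb: "z = c" if "f = {b, z}" for z
      proof (rule ccontr)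
        assume "z \<noteq> c"
        moreover have "z \<noteq> b" using graphsD[OF X] f(1) that by blast
        ultimately have "\<tau> ` f = {\<sigma> c, \<sigma> z}" using that \<tau>v by simp
        then have "{\<sigma> c, \<sigma> z} \<in> Y" using f(2) by simp
        moreover have "{b, z} \<in> X" using f(1) that by simp
        ultimately show False using no1 by blast
      qed
      have nc: "z = b" if "f = {c, z}" for z
      proof (rule ccontr)
        assume "z \<noteq> b"
        moreover have "z \<noteq> c" using graphsD[OF X] f(1) that by blast
        ultimately have "\<tau> ` f = {\<sigma> b, \<sigma> z}" using that \<tau>v by simp
        then have "{\<sigma> b, \<sigma> z} \<in> Y" using f(2) by simp
        moreover have "{c, z} \<in> X" using f(1) that by simp
        ultimately show False using no2 by blast
      qed
      have "f \<noteq> {a, b}" using nb[of a] c(2) by (auto simp: insert_commute)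
      moreover have "\<tau> ` f = \<sigma> ` f"
      proof (cases "f = {b, c}")
        case True
        then show ?thesis using \<tau>v by (auto simp: insert_commute)
      next
        case False
        have yx: "f = {y, x}" using xy by (simp add: insert_commute)
        have "x \<noteq> b" using nb[of y] xy False by blast
        moreover have "y \<noteq> b" using nb[of x] yx False by blast
        moreover have "x \<noteq> c" using nc[of y] xy False by blast
        moreover have "y \<noteq> c" using nc[of x] yx False by blast
        ultimately have "x \<noteq> b" "y \<noteq> b" "x \<noteq> c" "y \<noteq> c" .
        then show ?thesis using \<tau>v xy by simp
      qed
      ultimately show "f \<in> Cf \<sigma> - {{a, b}}" using f by (auto simp: Cf_def)
    qed
    moreover have "{a, b} \<in> Cf \<sigma>" using ab conf by (simp add: Cf_def)
    ultimately have "Cf \<tau> \<subset> Cf \<sigma>" by blast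
    then have "card (Cf \<tau>) < card (Cf \<sigma>)" using finC psubset_card_mono by blast
    then show False using min[OF \<tau>] by simp
  qed
  then show ?thesis using \<sigma> by blast
qed

lemma small_degrees_disconnected:
  assumes X: "X \<in> graphs n" and Y: "Y \<in> graphs n"
    and dX: "\<And>v. v < n \<Longrightarrow> card (neighbours X {v}) \<le> d"
    and dY: "\<And>v. v < n \<Longrightarrow> card (neighbours Y {v}) \<le> e"
    and small: "2 * d * e + 1 < n"
  shows "\<not> FS_connected n X Y"
proof -
  obtain \<sigma> where \<sigma>: "\<sigma> permutes {..<n}" "\<And>x y. {x, y} \<in> X \<Longrightarrow> {\<sigma> x, \<sigma> y} \<notin> Y"
    using edge_disjoint_placement[OF assms] by blast
  obtain \<tau> where "\<tau> \<in> FS_vertices n" "\<tau> 0 \<noteq> 0" using exists_moving_permutation[of n 0] small by auto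
  then have "\<sigma> \<circ> \<tau> \<in> FS_vertices n" "\<sigma> \<circ> \<tau> \<noteq> \<sigma>"
    using \<sigma>(1) permutes_inj[OF \<sigma>(1)] permutes_compose unfolding FS_vertices_def
    by (auto simp: fun_eq_iff inj_eq)
  then show ?thesis
    using \<sigma> by (intro FS_not_connectedI[of \<sigma> n "\<sigma> \<circ> \<tau>" "\<lambda>u. u = \<sigma>"]) (auto simp: FS_vertices_def FS_adj_def)
qed

section \<open>Degrees and Chernoff's bound\<close>

definition star :: "nat \<Rightarrow> nat \<Rightarrow> nat set set" where
  "star n v = (\<lambda>w. {v, w}) ` ({..<n} - {v})"

lemma star_subset: "v < n \<Longrightarrow> star n v \<subseteq> all_edges n"
  unfolding star_def all_edges_def by blast

lemma inj_on_star: "inj_on (\<lambda>w. {v, w}) ({..<n} - {v})"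
  by (rule inj_onI) (auto simp: doubleton_eq_iff)

lemma card_star: "v < n \<Longrightarrow> card (star n v) = n - 1"
  unfolding star_def by (simp add: card_image[OF inj_on_star])

lemma card_star_Un:
  assumes "u < n" "v < n" "u \<noteq> v"
  shows "card (star n u \<union> star n v) = 2 * n - 3"
proof -
  have fin: "finite (star n w)" for w unfolding star_def by auto
  have "star n u \<inter> star n v = {{u, v}}"
    using assms unfolding star_def by (auto simp: doubleton_eq_iff image_iff)
  then have "card (star n u) + card (star n v) = card (star n u \<union> star n v) + 1"
    using card_Un_Int[OF fin fin, of u v] by simp
  then show ?thesis using card_star assms by simp
qed

lemma card_neighbours_star:
  assumes "G \<in> graphs n"
  shows "card (neighbours G {v}) = card (G \<inter> star n v)"
proof -
  have "G \<inter> star n v = (\<lambda>w. {v, w}) ` neighbours G {v}"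
    using graphsD[OF assms] unfolding star_def neighbours_def by (auto simp: image_iff)
  moreover have "neighbours G {v} \<subseteq> {..<n} - {v}"
    using graphsD[OF assms] unfolding neighbours_def by auto
  ultimately show ?thesis using card_image inj_on_subset[OF inj_on_star] by metis
qed

text \<open>Markov's inequality for x to the power of the degree; x = 1 + \<delta> minimises the
  resulting bound exp ((x - 1) n p) / x^t at the threshold t = (1 + \<delta>) n p.\<close>

lemma degree_prob_le:
  assumes p: "0 \<le> p" "p \<le> 1" and v: "v < n" and "0 < \<delta>"
  shows "rg_prob n p (\<lambda>G. (1 + \<delta>) * (real n * p) \<le> real (card (neighbours G {v})))
    \<le> exp (- (((1 + \<delta>) * ln (1 + \<delta>) - \<delta>) * (real n * p)))"
proof -
  define x where "x = 1 + \<delta>"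
  define t where "t = x * (real n * p)"
  have x: "1 < x" unfolding x_def using \<open>0 < \<delta>\<close> by simp
  have "x powr t * rg_prob n p (\<lambda>G. t \<le> real (card (neighbours G {v})))
    \<le> (\<Sum>G\<in>graphs n. gnp_prob n p G * x ^ card (G \<inter> star n v))"
    unfolding rg_prob_def sum_distrib_left
  proof (rule sum_mono)
    fix G assume G: "G \<in> graphs n"
    show "x powr t * (if t \<le> real (card (neighbours G {v})) then gnp_prob n p G else 0)
      \<le> gnp_prob n p G * x ^ card (G \<inter> star n v)"
    proof (cases "t \<le> real (card (neighbours G {v}))")
      case True
      have "x powr t \<le> x powr real (card (G \<inter> star n v))"
        using True x card_neighbours_star[OF G] by (intro powr_mono) auto
      then have "x powr t \<le> x ^ card (G \<inter> star n v)" using x by (simp add: powr_realpow)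
      then have "gnp_prob n p G * x powr t \<le> gnp_prob n p G * x ^ card (G \<inter> star n v)"
        using gnp_prob_nonneg[OF p] by (rule mult_left_mono)
      then show ?thesis using True by (simp add: mult.commute)
    next
      case False
      then show ?thesis using gnp_prob_nonneg[OF p, of n G] x by simp
    qed
  qed
  also have "\<dots> = (1 - p + p * x) ^ (n - 1)"
    using gnp_expectation_power[OF star_subset[OF v]] card_star[OF v] by simp
  also have "\<dots> \<le> (1 - p + p * x) ^ n"
    using p x by (intro power_increasing) (auto simp: x_def algebra_simps)
  also have "\<dots> \<le> exp (p * \<delta>) ^ n"
    using exp_ge_add_one_self[of "p * \<delta>"] p x by (intro power_mono) (auto simp: x_def algebra_simps)
  also have "\<dots> = exp (\<delta> * (real n * p))" by (simp add: exp_of_nat_mult[symmetric] mult_ac)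
  finally have "x powr t * rg_prob n p (\<lambda>G. t \<le> real (card (neighbours G {v}))) \<le> exp (\<delta> * (real n * p))" .
  then have "rg_prob n p (\<lambda>G. t \<le> real (card (neighbours G {v}))) \<le> exp (\<delta> * (real n * p)) / x powr t"
    using x by (simp add: pos_le_divide_eq mult.commute)
  also have "\<dots> = exp (- ((x * ln x - \<delta>) * (real n * p)))"
    using x by (simp add: powr_def exp_diff[symmetric] t_def algebra_simps)
  finally show ?thesis unfolding t_def x_def .
qed

lemma max_degree_prob_le:
  assumes p: "0 \<le> p" "p \<le> 1" and "0 < \<delta>"
  shows "rg_prob n p (\<lambda>G. \<exists>v<n. (1 + \<delta>) * (real n * p) \<le> real (card (neighbours G {v})))
    \<le> real n * exp (- (((1 + \<delta>) * ln (1 + \<delta>) - \<delta>) * (real n * p)))"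
proof -
  have "rg_prob n p (\<lambda>G. \<exists>v<n. (1 + \<delta>) * (real n * p) \<le> real (card (neighbours G {v})))
    \<le> (\<Sum>v<n. rg_prob n p (\<lambda>G. (1 + \<delta>) * (real n * p) \<le> real (card (neighbours G {v}))))"
    by (rule rg_prob_union_bound[OF p]) auto
  also have "\<dots> \<le> (\<Sum>v<n. exp (- (((1 + \<delta>) * ln (1 + \<delta>) - \<delta>) * (real n * p))))"
    by (rule sum_mono) (use degree_prob_le[OF p _ \<open>0 < \<delta>\<close>] in auto)
  finally show ?thesis by simp
qed

lemma FS_disconnected_whp_sparse:
  fixes \<epsilon> :: real and p1 p2 :: "nat \<Rightarrow> real"
  assumes "\<epsilon> > 0" and p: "\<And>n. 0 \<le> p1 n \<and> p1 n \<le> 1" "\<And>n. 0 \<le> p2 n \<and> p2 n \<le> 1"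
    and prod: "eventually (\<lambda>n. p1 n * p2 n \<le> ((1 - \<epsilon>) / 2) / real n) sequentially"
    and large: "(\<lambda>n. ln (real n) / real n) \<in> o(p1)" "(\<lambda>n. ln (real n) / real n) \<in> o(p2)"
  shows "whp (\<lambda>n. pair_prob n (p1 n) (p2 n) (\<lambda>X Y. \<not> FS_connected n X Y))"
proof (rule whp_pair_probI[OF p])
  define \<delta> where "\<delta> = \<epsilon> / 2"
  define c where "c = (1 + \<delta>) * ln (1 + \<delta>) - \<delta>"
  have \<delta>: "0 < \<delta>" using \<open>\<epsilon> > 0\<close> by (simp add: \<delta>_def)
  have c: "0 < c"
  proof -
    have "ln (1 / (1 + \<delta>)) < 1 / (1 + \<delta>) - 1"
      using \<delta> ln_le_minus_one[of "1 / (1 + \<delta>)"] ln_eq_minus_one[of "1 / (1 + \<delta>)"] by fastforce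
    then have "1 - 1 / (1 + \<delta>) < ln (1 + \<delta>)" using \<delta> by (simp add: ln_div)
    then have "(1 + \<delta>) * (1 - 1 / (1 + \<delta>)) < (1 + \<delta>) * ln (1 + \<delta>)" using \<delta> by (intro mult_strict_left_mono) auto
    moreover have "(1 + \<delta>) * (1 - 1 / (1 + \<delta>)) = \<delta>" using \<delta> by (simp add: field_simps)
    ultimately show ?thesis by (simp add: c_def)
  qed
  \<comment> \<open>The choice \<delta> = \<epsilon>/2 keeps (1 + \<delta>)^2 (1 - \<epsilon>) below
    1; a is the gap, and a n > 1 absorbs the additive 1 in the degree condition of Sauer and
    Spencer.\<close>
  define a where "a = 1 - (1 + \<delta>)\<^sup>2 * (1 - \<epsilon>)"
  have a: "0 < a"
  proof -
    have "a = \<epsilon> * \<epsilon> * (3 + \<epsilon>) / 4" unfolding a_def \<delta>_def by (simp add: power2_eq_square field_simps)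
    moreover have "0 < \<epsilon> * \<epsilon> * (3 + \<epsilon>) / 4" using \<open>\<epsilon> > 0\<close> by (intro divide_pos_pos mult_pos_pos) auto
    ultimately show ?thesis by linarith
  qed
  show "(\<lambda>n. 2 / real n) \<longlonglongrightarrow> 0" by real_asymp
  \<comment> \<open>Here log n / n = o(q) enters: the Chernoff exponent c n q exceeds 2 log n, so
    the union over n vertices costs no more than 1/n.\<close>
  have big: "eventually (\<lambda>n. 2 * ln (real n) \<le> c * (real n * q n)) sequentially"
    if q: "(\<lambda>n. ln (real n) / real n) \<in> o(q)" "\<And>n. 0 \<le> q n" for q
  proof -
    have "eventually (\<lambda>n. norm (ln (real n) / real n) \<le> c / 2 * norm (q n)) sequentially"
      using landau_o.smallD[OF q(1), of "c / 2"] c by simp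
    then show ?thesis using eventually_gt_at_top[of 0]
    proof eventually_elim
      case (elim n)
      have "ln (real n) / real n \<le> norm (ln (real n) / real n)" unfolding real_norm_def by (rule abs_ge_self)
      then have "ln (real n) / real n \<le> c / 2 * q n" using elim(1) q(2)[of n] by simp
      then show ?case using elim(2) by (simp add: field_simps)
    qed
  qed
  have "eventually (\<lambda>n. 1 < a * real n) sequentially" using a by real_asymp
  then show "eventually (\<lambda>n. pair_prob n (p1 n) (p2 n) (\<lambda>X Y. \<not> \<not> FS_connected n X Y) \<le> 2 / real n) sequentially"
    using prod big[OF large(1) conjunct1[OF p(1)]] big[OF large(2) conjunct1[OF p(2)]] eventually_gt_at_top[of 0]
  proof eventually_elim
    case (elim n)
    have n: "0 < real n" using elim by simp
    define B where "B = (\<lambda>q G. \<exists>v<n. (1 + \<delta>) * (real n * q) \<le> real (card (neighbours G {v})))"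
    have small: "rg_prob n q (B q) \<le> 1 / real n" if "0 \<le> q" "q \<le> 1" "2 * ln (real n) \<le> c * (real n * q)" for q
    proof -
      have "rg_prob n q (B q) \<le> real n * exp (- (c * (real n * q)))"
        unfolding B_def c_def by (rule max_degree_prob_le[OF that(1,2) \<delta>])
      also have "\<dots> \<le> real n * exp (real 2 * - ln (real n))" using that(3) n by (intro mult_left_mono) auto
      also have "\<dots> = 1 / real n"
        unfolding exp_of_nat_mult using n by (simp add: exp_minus power2_eq_square field_simps)
      finally show ?thesis .
    qed
    have "pair_prob n (p1 n) (p2 n) (\<lambda>X Y. \<not> \<not> FS_connected n X Y) \<le> rg_prob n (p1 n) (B (p1 n)) + rg_prob n (p2 n) (B (p2 n)) + 0"
    proof (rule pair_prob_le[where C = "\<lambda>X Y. False"])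
      fix X Y assume XY: "X \<in> graphs n" "Y \<in> graphs n" and conn: "\<not> \<not> FS_connected n X Y"
      show "B (p1 n) X \<or> B (p2 n) Y \<or> False"
      proof (rule ccontr)
        assume not: "\<not> ?thesis"
        let ?d = "\<lambda>q. nat \<lfloor>(1 + \<delta>) * (real n * q)\<rfloor>"
        have deg: "card (neighbours G {v}) \<le> ?d q" if "\<not> B q G" "v < n" for q G v
        proof -
          have "real (card (neighbours G {v})) \<le> (1 + \<delta>) * (real n * q)"
            using that unfolding B_def by (auto simp: not_le intro: less_imp_le)
          then show ?thesis by (simp add: le_nat_floor)
        qed
        have d0: "real (?d q) \<le> (1 + \<delta>) * (real n * q)" if "0 \<le> q" for q
          using that \<delta> by simp
        have "real (?d (p1 n)) * real (?d (p2 n)) \<le> ((1 + \<delta>) * (real n * p1 n)) * ((1 + \<delta>) * (real n * p2 n))"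
          using d0 p \<delta> by (intro mult_mono) auto
        also have "\<dots> = (1 + \<delta>)\<^sup>2 * real n * (real n * (p1 n * p2 n))" by (simp add: power2_eq_square mult_ac)
        also have "\<dots> \<le> (1 + \<delta>)\<^sup>2 * real n * ((1 - \<epsilon>) / 2)"
          using elim n \<delta> by (intro mult_left_mono) (auto simp: field_simps)
        also have "\<dots> = (real n - a * real n) / 2" by (simp add: a_def field_simps)
        finally have "real (2 * ?d (p1 n) * ?d (p2 n) + 1) < real n" using elim by simp
        then have "2 * ?d (p1 n) * ?d (p2 n) + 1 < n" by (simp only: of_nat_less_iff)
        then have "\<not> FS_connected n X Y"
          using not by (intro small_degrees_disconnected[OF XY, of "?d (p1 n)" "?d (p2 n)"] deg) auto
        then show False using conn by blast
      qed
    qed (use p in \<open>auto simp: rg_prob_def\<close>)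
    also have "\<dots> \<le> 1 / real n + 1 / real n"
      using small[of "p1 n"] small[of "p2 n"] p elim by simp
    finally show ?case by simp
  qed
qed

section \<open>Isolated vertices and the second moment\<close>

text \<open>Chebyshev's inequality at N = 0, where N counts the isolated vertices and E is its mean.
  The diagonal of the second moment gives 1/E. Two stars share one edge, so a pair is isolated with
  1/(1 - p) times the product of the probabilities, which leaves p/(1 - p).\<close>

lemma no_isolated_prob_le:
  assumes p: "0 \<le> p" "p < 1" and n: "2 \<le> n"
  shows "rg_prob n p (\<lambda>G. \<forall>v<n. \<exists>w. {v, w} \<in> G) \<le> 1 / (real n * (1 - p) ^ (n - 1)) + p / (1 - p)"
proof -
  define q where "q = 1 - p"
  have q: "0 < q" using p by (simp add: q_def)
  define Z where "Z = (\<lambda>v G. if G \<inter> star n v = {} then 1 else 0 :: real)"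
  define N where "N = (\<lambda>G. \<Sum>v<n. Z v G)"
  define E where "E = real n * q ^ (n - 1)"
  let ?\<mu> = "gnp_prob n p"
  have p': "p \<le> 1" using p by simp
  have \<mu>0: "0 \<le> ?\<mu> G" for G by (rule gnp_prob_nonneg[OF p(1) p'])
  have E0: "0 < E" using q n by (simp add: E_def)
  have no: "(\<Sum>G\<in>graphs n. ?\<mu> G * (if G \<inter> D = {} then 1 else 0)) = q ^ card D" if "D \<subseteq> all_edges n" for D
    using rg_prob_no_edges[OF that, of p] unfolding rg_prob_def q_def by (simp add: if_distrib cong: if_cong)
  have EN: "(\<Sum>G\<in>graphs n. ?\<mu> G * N G) = E"
  proof -
    have "(\<Sum>G\<in>graphs n. ?\<mu> G * N G) = (\<Sum>v<n. \<Sum>G\<in>graphs n. ?\<mu> G * Z v G)"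
      unfolding N_def sum_distrib_left by (rule sum.swap)
    also have "\<dots> = (\<Sum>v<n. q ^ (n - 1))"
      unfolding Z_def by (rule sum.cong) (auto simp: no[OF star_subset] card_star)
    finally show ?thesis by (simp add: E_def)
  qed
  have EN2: "(\<Sum>G\<in>graphs n. ?\<mu> G * (N G)\<^sup>2) \<le> E + real n * (real n * q ^ (2 * n - 3))"
  proof -
    have "(\<Sum>G\<in>graphs n. ?\<mu> G * (N G)\<^sup>2) = (\<Sum>G\<in>graphs n. \<Sum>u<n. \<Sum>v<n. ?\<mu> G * (Z u G * Z v G))"
    proof (rule sum.cong[OF refl])
      fix G
      have "(N G)\<^sup>2 = (\<Sum>u<n. \<Sum>v<n. Z u G * Z v G)" unfolding N_def power2_eq_square sum_product ..
      then show "?\<mu> G * (N G)\<^sup>2 = (\<Sum>u<n. \<Sum>v<n. ?\<mu> G * (Z u G * Z v G))" by (simp only: sum_distrib_left)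
    qed
    also have "\<dots> = (\<Sum>u<n. \<Sum>G\<in>graphs n. \<Sum>v<n. ?\<mu> G * (Z u G * Z v G))" by (rule sum.swap)
    also have "\<dots> = (\<Sum>u<n. \<Sum>v<n. \<Sum>G\<in>graphs n. ?\<mu> G * (Z u G * Z v G))" by (intro sum.cong refl sum.swap)
    also have "\<dots> = (\<Sum>u<n. \<Sum>v<n. q ^ card (star n u \<union> star n v))"
    proof (intro sum.cong refl)
      fix u v assume "u \<in> {..<n}" "v \<in> {..<n}"
      then have sub: "star n u \<union> star n v \<subseteq> all_edges n" using star_subset by auto
      have "Z u G * Z v G = (if G \<inter> (star n u \<union> star n v) = {} then 1 else 0)" for G
        unfolding Z_def by auto
      then show "(\<Sum>G\<in>graphs n. ?\<mu> G * (Z u G * Z v G)) = q ^ card (star n u \<union> star n v)"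
        using no[OF sub] by simp
    qed
    also have "\<dots> \<le> (\<Sum>u<n. \<Sum>v<n. (if u = v then q ^ (n - 1) else 0) + q ^ (2 * n - 3))"
    proof (intro sum_mono)
      fix u v assume "u \<in> {..<n}" "v \<in> {..<n}"
      then show "q ^ card (star n u \<union> star n v) \<le> (if u = v then q ^ (n - 1) else 0) + q ^ (2 * n - 3)"
        using card_star_Un[of u n v] card_star[of u n] q by (cases "u = v") auto
    qed
    also have "\<dots> = E + real n * (real n * q ^ (2 * n - 3))"
      by (simp add: sum.distrib E_def distrib_left)
    finally show ?thesis .
  qed
  have "E\<^sup>2 * rg_prob n p (\<lambda>G. \<forall>v<n. \<exists>w. {v, w} \<in> G) \<le> (\<Sum>G\<in>graphs n. ?\<mu> G * (N G - E)\<^sup>2)"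
    unfolding rg_prob_def sum_distrib_left
  proof (rule sum_mono)
    fix G assume G: "G \<in> graphs n"
    show "E\<^sup>2 * (if \<forall>v<n. \<exists>w. {v, w} \<in> G then ?\<mu> G else 0) \<le> ?\<mu> G * (N G - E)\<^sup>2"
    proof (cases "\<forall>v<n. \<exists>w. {v, w} \<in> G")
      case True
      have "Z v G = 0" if "v < n" for v
      proof -
        obtain w where w: "{v, w} \<in> G" using True \<open>v < n\<close> by blast
        then have "w < n" "v \<noteq> w" using graphsD[OF G w] by auto
        then have "{v, w} \<in> star n v" unfolding star_def by auto
        then show ?thesis using w unfolding Z_def by auto
      qed
      then have "N G = 0" unfolding N_def by simp
      then show ?thesis using True by (simp add: mult.commute)
    next
      case False
      then show ?thesis using \<mu>0 by auto
    qed
  qed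
  also have "\<dots> = (\<Sum>G\<in>graphs n. ?\<mu> G * (N G)\<^sup>2 - 2 * E * (?\<mu> G * N G) + E\<^sup>2 * ?\<mu> G)"
    by (rule sum.cong) (simp_all add: power2_diff algebra_simps)
  also have "\<dots> = (\<Sum>G\<in>graphs n. ?\<mu> G * (N G)\<^sup>2) - E\<^sup>2"
    by (simp add: sum.distrib sum_subtractf sum_distrib_left[symmetric] EN gnp_prob_sum power2_eq_square)
  also have "\<dots> \<le> E + real n * (real n * q ^ (2 * n - 3)) - E\<^sup>2" using EN2 by simp
  finally have "rg_prob n p (\<lambda>G. \<forall>v<n. \<exists>w. {v, w} \<in> G) \<le> (E + real n * (real n * q ^ (2 * n - 3)) - E\<^sup>2) / E\<^sup>2"
    using E0 by (simp add: pos_le_divide_eq mult.commute)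
  also have "\<dots> = 1 / E + p / q"
  proof -
    \<comment> \<open>Turns the truncated differences 2 n - 3 and n - 1 into sums.\<close>
    obtain k where k: "n = 2 + k" using n le_Suc_ex by blast
    have "2 * n - 3 = k + Suc k" "n - 1 = Suc k" using k by auto
    then have "real n * (real n * q ^ (2 * n - 3)) * q = E\<^sup>2"
      by (simp add: E_def power2_eq_square power_add)
    then have "real n * (real n * q ^ (2 * n - 3)) = E\<^sup>2 / q" using q by (simp add: field_simps)
    moreover have "(E + E\<^sup>2 / q - E\<^sup>2) / E\<^sup>2 = 1 / E + (1 / q - 1)"
      using E0 by (simp add: diff_divide_distrib add_divide_distrib power2_eq_square)
    moreover have "1 / q - 1 = p / q" using q by (simp add: q_def field_simps)
    ultimately show ?thesis by simp
  qed
  finally show ?thesis unfolding E_def q_def .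
qed

text \<open>Uniform in p because the graph with the smaller density may change with n. Once c n <=
  0, p <= log n / n makes 2 n p^2 at most 1 for large n, and ln (1 - p) >= - p - 2 p^2 gives a mean
  of at least exp (- c n - 1) isolated vertices.\<close>

lemma no_isolated_prob_tendsto:
  assumes c: "filterlim c at_bot sequentially"
  shows "eventually (\<lambda>n. \<forall>p. 0 \<le> p \<longrightarrow> p \<le> (ln (real n) + c n) / real n \<longrightarrow>
    rg_prob n p (\<lambda>G. \<forall>v<n. \<exists>w. {v, w} \<in> G) \<le> exp (c n + 1) + 2 * (ln (real n) / real n)) sequentially"
proof -
  have e0: "eventually (\<lambda>n. c n \<le> 0) sequentially" using c by (simp add: filterlim_at_bot)
  have e1: "eventually (\<lambda>n. 2 * (ln (real n))\<^sup>2 / real n \<le> 1) sequentially" by real_asymp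
  have e2: "eventually (\<lambda>n. ln (real n) / real n \<le> 1 / 2) sequentially" by real_asymp
  show ?thesis
    using e0 e1 e2 eventually_ge_at_top[of 2]
  proof eventually_elim
    case (elim n)
    show ?case
    proof (intro allI impI)
      fix p assume p0: "0 \<le> p" and pc: "p \<le> (ln (real n) + c n) / real n"
      define L where "L = ln (real n)"
      have n: "0 < real n" using elim by simp
      have np: "real n * p \<le> L + c n" using pc n by (simp add: L_def field_simps)
      have pL: "p \<le> L / real n"
      proof -
        have "(L + c n) / real n \<le> L / real n" using elim(1) n by (intro divide_right_mono) auto
        then show ?thesis using pc by (simp add: L_def)
      qed
      then have half: "p \<le> 1 / 2" using elim(3) unfolding L_def by linarith
      have L0: "0 \<le> L" using elim by (simp add: L_def)
      have "real n * (2 * p\<^sup>2) \<le> real n * (2 * (L / real n)\<^sup>2)"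
        using p0 pL by (intro mult_left_mono power_mono) auto
      also have "\<dots> = 2 * L\<^sup>2 / real n" using n by (simp add: power2_eq_square)
      also have "\<dots> \<le> 1" using elim(2) by (simp add: L_def)
      finally have sq: "real n * (2 * p\<^sup>2) \<le> 1" .
      have "- p - 2 * p\<^sup>2 \<le> ln (1 - p)" using ln_one_minus_pos_lower_bound[of p] p0 half by simp
      then have "real n * (- p - 2 * p\<^sup>2) \<le> real n * ln (1 - p)" using n by (intro mult_left_mono) auto
      then have "- c n - 1 \<le> L + real n * ln (1 - p)" using np sq by (simp add: algebra_simps)
      then have "exp (- c n - 1) \<le> exp (L + real n * ln (1 - p))" by simp
      also have "\<dots> = real n * (1 - p) ^ n" using n half by (simp add: L_def exp_add exp_of_nat_mult)
      also have "\<dots> \<le> real n * (1 - p) ^ (n - 1)"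
        using p0 half by (intro mult_left_mono power_decreasing) auto
      finally have "1 / (real n * (1 - p) ^ (n - 1)) \<le> 1 / exp (- c n - 1)"
        using n half by (intro divide_left_mono mult_pos_pos) auto
      also have "1 / exp (- c n - 1) = exp (c n + 1)"
      proof -
        have "- c n - 1 = - (c n + 1)" by simp
        then show ?thesis by (simp only: exp_minus inverse_eq_divide) simp
      qed
      finally have t1: "1 / (real n * (1 - p) ^ (n - 1)) \<le> exp (c n + 1)" .
      have "p / (1 - p) \<le> (L / real n) / (1 / 2)" using p0 pL half by (intro frac_le) auto
      then have t2: "p / (1 - p) \<le> 2 * (L / real n)" by (simp add: mult.commute)
      have "rg_prob n p (\<lambda>G. \<forall>v<n. \<exists>w. {v, w} \<in> G) \<le> 1 / (real n * (1 - p) ^ (n - 1)) + p / (1 - p)"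
        by (rule no_isolated_prob_le) (use p0 half elim in auto)
      then show "rg_prob n p (\<lambda>G. \<forall>v<n. \<exists>w. {v, w} \<in> G) \<le> exp (c n + 1) + 2 * (ln (real n) / real n)"
        using t1 t2 unfolding L_def by linarith
    qed
  qed
qed

lemma FS_disconnected_whp_isolated:
  fixes p1 p2 c :: "nat \<Rightarrow> real"
  assumes p: "\<And>n. 0 \<le> p1 n \<and> p1 n \<le> 1" "\<And>n. 0 \<le> p2 n \<and> p2 n \<le> 1"
    and c: "filterlim c at_bot sequentially"
    and min: "eventually (\<lambda>n. min (p1 n) (p2 n) \<le> (ln (real n) + c n) / real n) sequentially"
  shows "whp (\<lambda>n. pair_prob n (p1 n) (p2 n) (\<lambda>X Y. \<not> FS_connected n X Y))"
proof (rule whp_pair_probI[OF p])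
  have "filterlim (\<lambda>n. c n + 1) at_bot sequentially"
    using filterlim_tendsto_add_at_bot_iff[OF tendsto_const[of 1], of c] c by (simp add: add.commute)
  then have "(\<lambda>n. exp (c n + 1)) \<longlonglongrightarrow> 0" by (rule filterlim_compose[OF exp_at_bot])
  moreover have "(\<lambda>n. 2 * (ln (real n) / real n)) \<longlonglongrightarrow> 0" by real_asymp
  ultimately show "(\<lambda>n. exp (c n + 1) + 2 * (ln (real n) / real n)) \<longlonglongrightarrow> 0"
    using tendsto_add by fastforce
  show "eventually (\<lambda>n. pair_prob n (p1 n) (p2 n) (\<lambda>X Y. \<not> \<not> FS_connected n X Y)
    \<le> exp (c n + 1) + 2 * (ln (real n) / real n)) sequentially"
    using no_isolated_prob_tendsto[OF c] min eventually_ge_at_top[of 2]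
  proof eventually_elim
    case (elim n)
    let ?iso = "\<lambda>G. \<forall>v<n. \<exists>w. {v, w} \<in> G"
    let ?F = "\<lambda>G :: nat set set. False"
    have disc: "?iso X \<and> ?iso Y" if "\<not> \<not> FS_connected n X Y" for X Y
      using that isolated_disconnected[OF elim(3)] by blast
    have F: "rg_prob n q ?F = 0" for q by (simp add: rg_prob_def)
    consider "p1 n \<le> (ln (real n) + c n) / real n" | "p2 n \<le> (ln (real n) + c n) / real n"
      using elim(2) by linarith
    then show ?case
    proof cases
      case 1
      have "pair_prob n (p1 n) (p2 n) (\<lambda>X Y. \<not> \<not> FS_connected n X Y) \<le> rg_prob n (p1 n) ?iso + rg_prob n (p2 n) ?F + 0"
        by (rule pair_prob_le[where C = "\<lambda>X Y. False"]) (use p disc F in auto)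
      then show ?thesis using elim(1) 1 p F by fastforce
    next
      case 2
      have "pair_prob n (p1 n) (p2 n) (\<lambda>X Y. \<not> \<not> FS_connected n X Y) \<le> rg_prob n (p1 n) ?F + rg_prob n (p2 n) ?iso + 0"
        by (rule pair_prob_le[where C = "\<lambda>X Y. False"]) (use p disc F in auto)
      then show ?thesis using elim(1) 2 p F by fastforce
    qed
  qed
qed

theorem theorem2:
  fixes \<epsilon> :: real and p1 p2 :: "nat \<Rightarrow> real"
  assumes "\<epsilon> > 0"
    and "\<And>n. 0 \<le> p1 n \<and> p1 n \<le> 1"
    and "\<And>n. 0 \<le> p2 n \<and> p2 n \<le> 1"
  shows
    "((((eventually (\<lambda>n. p1 n * p2 n \<le> ((1 - \<epsilon>) / 2) / real n) sequentially)
        \<and> (\<lambda>n. ln (real n) / real n) \<in> o(p1)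
        \<and> (\<lambda>n. ln (real n) / real n) \<in> o(p2))
      \<or> (\<exists>c :: nat \<Rightarrow> real. filterlim c at_bot sequentially \<and>
           eventually (\<lambda>n. min (p1 n) (p2 n) \<le> (ln (real n) + c n) / real n) sequentially))
     \<longrightarrow> whp (\<lambda>n. pair_prob n (p1 n) (p2 n) (\<lambda>GX GY. \<not> FS_connected n GX GY)))
   \<and> ((eventually (\<lambda>n. p1 n * p2 n \<ge> (p0 n)^2
        \<and> p1 n \<ge> 2 / (ln (real n) powr (1/3)) * p0 n
        \<and> p2 n \<ge> 2 / (ln (real n) powr (1/3)) * p0 n) sequentially)
     \<longrightarrow> whp (\<lambda>n. pair_prob n (p1 n) (p2 n) (\<lambda>GX GY. FS_connected n GX GY)))"
proof (intro conjI impI)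
  assume ev: "eventually (\<lambda>n. p1 n * p2 n \<ge> (p0 n)^2
        \<and> p1 n \<ge> 2 / (ln (real n) powr (1/3)) * p0 n
        \<and> p2 n \<ge> 2 / (ln (real n) powr (1/3)) * p0 n) sequentially"
  have "eventually (\<lambda>n. p1 n \<ge> 300 * ln (real n) / sqrt (real n) \<and> p2 n \<ge> 300 * ln (real n) / sqrt (real n)) sequentially"
    using ev p0_lower_bound by eventually_elim linarith
  then show "whp (\<lambda>n. pair_prob n (p1 n) (p2 n) (\<lambda>GX GY. FS_connected n GX GY))"
    by (rule FS_connected_whp[OF assms(2,3)])
next
  assume sparse: "(eventually (\<lambda>n. p1 n * p2 n \<le> ((1 - \<epsilon>) / 2) / real n) sequentially)
        \<and> (\<lambda>n. ln (real n) / real n) \<in> o(p1)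
        \<and> (\<lambda>n. ln (real n) / real n) \<in> o(p2)
      \<or> (\<exists>c :: nat \<Rightarrow> real. filterlim c at_bot sequentially \<and>
           eventually (\<lambda>n. min (p1 n) (p2 n) \<le> (ln (real n) + c n) / real n) sequentially)"
  show "whp (\<lambda>n. pair_prob n (p1 n) (p2 n) (\<lambda>GX GY. \<not> FS_connected n GX GY))"
    using sparse
    by (elim disjE conjE exE)
      (fact FS_disconnected_whp_sparse[OF assms] FS_disconnected_whp_isolated[OF assms(2,3)])+
qed

end
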